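(* There exist absolute positive constants $C_1,C_2,C_3$ such that the following holds. Let $d\ge 2$ be an integer, let $s:=d(d+3)$, let $0<N\le \frac{1}{40\pi\sqrt{d}}$, let $0<\delta<\infty$, and let $V\subset E(s,N)\subset\mathbb{R}^s$ be a convex set such that $$\frac{|E(4,N)|}{|\pi(V)|}\le\delta .$$ Then for every $T\ge 0$, $$|\{v\in V:\ C(v)\ge T\}|\le C_1\,\delta\, d^{C_2}e^{-C_3T}\cdot|V| .$$
   Context: For an integer $d\ge 2$ consider the real planar polynomial system $$\dot x=-y+F(x,y),\qquad \dot y=x+G(x,y),$$ $$F(x,y)=\sum_{1\le i+k\le d}a_{ki}x^ky^i,\qquad G(x,y)=\sum_{1\le i+k\le d}b_{ki}x^ky^i,$$ where the indices $k,i$ are nonnegative integers. The real coefficients $(a_{ki}),(b_{ki})$ form a point $v\in\mathbb{R}^s$, with $s=d(d+3)$ the total number of coefficients, and $\mathbb{R}^s$ carries the Euclidean norm, $|v|^2=\sum|a_{ki}|^2+\sum|b_{ki}|^2$. $E(n,r)$ denotes the open Euclidean ball of radius $r$ in $\mathbb{R}^n$ centered at $0$. $C(v)$ is the number of limit cycles (isolated closed trajectories) of the system with coefficient vector $v$ that are situated in the disk $D_{1/2}=\{(x,y)\in\mathbb{R}^2:\ |x|^2+|y|^2\le 1/4\}$. $\pi:\mathbb{R}^s\to\mathbb{R}^4$ is the natural coordinate projection sending $v$ to the coefficients $(a_{10},a_{01},b_{10},b_{01})$ of the linear parts of $F$ and $G$. $|E(4,N)|$ and $|\pi(V)|$ are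 Lebesgue measures in $\mathbb{R}^4$. For a subset $E\subset V$ (in particular for $V$ itself), $|E|$ denotes Lebesgue measure in the real affine hull of $V$ (which may have dimension smaller than $s$). "Absolute" constants do not depend on $d,N,\delta,V,T$. *)

theory Defs
  imports "HOL-Analysis.Analysis" "HOL-Analysis.Finite_Function_Topology"
begin

section \<open>Coefficient vectors\<close>

text \<open>
  Since the degree \<open>d\<close> is quantified inside the theorem, \<open>\<real>\<^sup>s\<close> with \<open>s = d (d + 3)\<close> is not a type of
  its own but the linear subspace \<open>coeff_space d\<close> of a type that serves all degrees. An element is
  a pair \<open>(a, b)\<close> of coefficient families; \<open>lookup a (k, i)\<close> is the coefficient of \<open>x\<^sup>k y\<^sup>i\<close> in \<open>F\<close>,
  and \<open>lookup b (k, i)\<close> the one in \<open>G\<close>.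
\<close>

type_synonym coeffs = "((nat \<times> nat) \<Rightarrow>\<^sub>0 real) \<times> ((nat \<times> nat) \<Rightarrow>\<^sub>0 real)"

definition coeff_index :: "nat \<Rightarrow> (nat \<times> nat) set" where
  "coeff_index d = {(k, i). 1 \<le> i + k \<and> i + k \<le> d}"

definition coeff_space :: "nat \<Rightarrow> coeffs set" where
  "coeff_space d = {(a, b). Poly_Mapping.keys a \<subseteq> coeff_index d \<and> Poly_Mapping.keys b \<subseteq> coeff_index d}"

text \<open>
  The type class norm on \<open>\<Rightarrow>\<^sub>0\<close> is an \<open>\<ell>\<^sup>1\<close>-norm, so the Euclidean structure is introduced separately.
\<close>

definition coeff_inner :: "coeffs \<Rightarrow> coeffs \<Rightarrow> real" where
  "coeff_inner u v =
     (\<Sum>m \<in> Poly_Mapping.keys (fst u). Poly_Mapping.lookup (fst u) m * Poly_Mapping.lookup (fst v) m) +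
     (\<Sum>m \<in> Poly_Mapping.keys (snd u). Poly_Mapping.lookup (snd u) m * Poly_Mapping.lookup (snd v) m)"

definition coeff_norm :: "coeffs \<Rightarrow> real" where
  "coeff_norm v = sqrt (coeff_inner v v)"

definition coeff_ball :: "nat \<Rightarrow> real \<Rightarrow> coeffs set" where
  "coeff_ball d r = {v \<in> coeff_space d. coeff_norm v < r}"

definition linear_part :: "coeffs \<Rightarrow> real ^ 4" where
  "linear_part v = vector
     [Poly_Mapping.lookup (fst v) (1, 0), Poly_Mapping.lookup (fst v) (0, 1),
      Poly_Mapping.lookup (snd v) (1, 0), Poly_Mapping.lookup (snd v) (0, 1)]"

lemma card_coeff_index: "2 * card (coeff_index d) = d * (d + 3)"
proof (induction d)
  case 0
  have "coeff_index 0 = {}"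
    by (auto simp: coeff_index_def)
  then show ?case
    by simp
next
  case (Suc d)
  let ?A = "(\<lambda>k. (k, Suc d - k)) ` {..Suc d}"
  have eq: "coeff_index (Suc d) = coeff_index d \<union> ?A"
    by (auto simp: coeff_index_def image_iff)
  have "coeff_index d \<subseteq> {..d} \<times> {..d}"
    by (auto simp: coeff_index_def)
  then have "finite (coeff_index d)"
    by (rule finite_subset) simp
  moreover have "coeff_index d \<inter> ?A = {}"
    by (auto simp: coeff_index_def)
  moreover have "card ?A = Suc (Suc d)"
    by (subst card_image) (auto simp: inj_on_def)
  ultimately have "card (coeff_index (Suc d)) = card (coeff_index d) + Suc (Suc d)"
    unfolding eq by (subst card_Un_disjoint) auto
  with Suc.IH show ?case
    by (simp add: algebra_simps)
qed


section \<open>Lebesgue measure in the affine hull\<close>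

text \<open>
  \<open>frame A n p e\<close>: the map \<open>x \<mapsto> p + x\<^sub>0 e\<^sub>0 + \<dots> + x\<^sub>n\<^sub>-\<^sub>1 e\<^sub>n\<^sub>-\<^sub>1\<close> is an isometric parametrization of the
  affine subspace \<open>A\<close> by \<open>\<real>\<^sup>n\<close>. Every nonempty affine subspace of \<open>coeff_space d\<close> has one.
\<close>

definition frame :: "coeffs set \<Rightarrow> nat \<Rightarrow> coeffs \<Rightarrow> (nat \<Rightarrow> coeffs) \<Rightarrow> bool" where
  "frame A n p e \<longleftrightarrow>
     (\<forall>i<n. \<forall>j<n. coeff_inner (e i) (e j) = (if i = j then 1 else 0)) \<and>
     A = range (\<lambda>x :: nat \<Rightarrow> real. p + (\<Sum>i<n. x i *\<^sub>R e i))"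

text \<open>
  \<open>hull_measure V E\<close> is the Lebesgue measure of \<open>E\<close> in the affine hull of \<open>V\<close>, obtained by
  transport along an isometric parametrization; the choice of the latter is immaterial because
  Lebesgue measure on \<open>\<real>\<^sup>n\<close> is invariant under isometries. Taking the outer measure makes this the
  Lebesgue measure whenever \<open>E\<close> is Lebesgue measurable, without assigning a junk value otherwise.
\<close>

definition hull_measure :: "coeffs set \<Rightarrow> coeffs set \<Rightarrow> ennreal" where
  "hull_measure V E =
     (case (SOME (n, p, e). frame (affine hull V) n p e) of (n, p, e) \<Rightarrow>
        outer_measure_of (\<Pi>\<^sub>M i\<in>{..<n}. lborel)
          {x \<in> {..<n} \<rightarrow>\<^sub>E UNIV. p + (\<Sum>i<n. x i *\<^sub>R e i) \<in> E})"


section \<open>The planar system and its limit cycles\<close>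

definition poly2 :: "nat \<Rightarrow> ((nat \<times> nat) \<Rightarrow>\<^sub>0 real) \<Rightarrow> real \<Rightarrow> real \<Rightarrow> real" where
  "poly2 d c x y = (\<Sum>(k, i) \<in> coeff_index d. Poly_Mapping.lookup c (k, i) * x ^ k * y ^ i)"

definition vfield :: "nat \<Rightarrow> coeffs \<Rightarrow> real \<times> real \<Rightarrow> real \<times> real" where
  "vfield d v = (\<lambda>(x, y). (- y + poly2 d (fst v) x y, x + poly2 d (snd v) x y))"

definition closed_trajectory :: "nat \<Rightarrow> coeffs \<Rightarrow> (real \<times> real) set \<Rightarrow> bool" where
  "closed_trajectory d v \<Gamma> \<longleftrightarrow>
     (\<exists>\<gamma> :: real \<Rightarrow> real \<times> real. \<exists>p > 0.
        (\<forall>t. (\<gamma> has_vector_derivative vfield d v (\<gamma> t)) (at t)) \<and>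
        (\<forall>t. \<gamma> (t + p) = \<gamma> t) \<and> \<not> \<gamma> constant_on UNIV \<and> \<Gamma> = range \<gamma>)"

definition limit_cycle :: "nat \<Rightarrow> coeffs \<Rightarrow> (real \<times> real) set \<Rightarrow> bool" where
  "limit_cycle d v \<Gamma> \<longleftrightarrow> closed_trajectory d v \<Gamma> \<and>
     (\<exists>U. open U \<and> \<Gamma> \<subseteq> U \<and> (\<forall>\<Gamma>'. closed_trajectory d v \<Gamma>' \<and> \<Gamma>' \<subseteq> U \<longrightarrow> \<Gamma>' = \<Gamma>))"

definition half_disk :: "(real \<times> real) set" where
  "half_disk = {(x, y). \<bar>x\<bar>\<^sup>2 + \<bar>y\<bar>\<^sup>2 \<le> 1 / 4}"

text \<open>
  The number of limit cycles takes values in \<open>ennreal\<close>, so that an infinite set counts as \<open>\<infinity>\<close>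
  (the function \<open>card\<close> would return \<open>0\<close>).
\<close>

definition num_limit_cycles :: "nat \<Rightarrow> coeffs \<Rightarrow> ennreal" where
  "num_limit_cycles d v = emeasure (count_space UNIV) {\<Gamma>. limit_cycle d v \<Gamma> \<and> \<Gamma> \<subseteq> half_disk}"

end

theory Submission
  imports Defs "HOL-Complex_Analysis.Riemann_Mapping"
begin

text \<open>
  In polar coordinates a closed trajectory in the disk winds around the origin, and its intersection
  with the positive \<open>x\<close>-axis is a zero of \<open>g(\<rho>) = ln (r(2\<pi>; \<rho>) / \<rho>)\<close>, where \<open>r(\<cdot>; \<rho>)\<close> solves the
  equation for \<open>dr/d\<phi>\<close> with \<open>r(0) = \<rho>\<close>. This \<open>g\<close> is the limit of holomorphic Euler polygons on the
  complex disk of radius \<open>9/10\<close>, where it is bounded by \<open>9 \<surd>d N\<close>, so \<open>m\<close> zeros in \<open>(0, 1/2]\<close> force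
  \<open>|g(0)| \<le> 9 \<surd>d N (5/9)\<^sup>m\<close>. On the other hand \<open>|g(0)|\<close> dominates the trace \<open>\<tau> = a\<^sub>1\<^sub>0 + b\<^sub>0\<^sub>1\<close> of the
  perturbation, a linear functional of the coefficients. Hence \<open>C(v) \<ge> T\<close> confines \<open>v\<close> to the slab
  \<open>|\<tau>| \<le> 9 \<surd>d N (5/9)\<^sup>T\<close>. The assumption on \<open>\<pi>(V)\<close> makes \<open>|\<tau>|\<close> reach \<open>N / (32 \<delta>)\<close> on the convex set
  \<open>V\<close>, and a thin slab then carries only a small part of the volume of \<open>V\<close>.
\<close>

section \<open>Coefficient vectors as a Euclidean space\<close>

text \<open>The exponential gain needs a holomorphic function of the initial radius, but closed
  trajectories only provide real solutions of the polar equation. Euler polygons with real steps and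
  complex initial radius are holomorphic by construction and uniformly bounded, so Montel's theorem
  yields a holomorphic limit along a subsequence. This limit has to be identified with the return
  map only at the crossing radii and at 0, where real solutions on the whole line are at hand; a
  flow on complex initial values is thus never constructed. Working with
  \<open>ln (r / \<rho>)\<close> instead of \<open>r\<close> keeps 0 inside the domain, and the
  value there depends on the linear part alone. The bound on \<open>g\<close> must be proportional
  to \<open>N\<close>: the trace itself is of order at most \<open>N\<close> on \<open>V\<close>,
  and \<open>N\<close> cancels in the quotient of slab width and reach of the trace. Measurability
  of the set of \<open>v\<close> with many limit cycles is never established. The volume comparison
  therefore runs on outer measures: homotheties scale them, and disjoint measurable slabs separate
  the shrunken copies.\<close>

lemma lookup_scaleR: "Poly_Mapping.lookup (c *\<^sub>R f) k = c *\<^sub>R Poly_Mapping.lookup f k"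
proof -
  have "{i. c *\<^sub>R Poly_Mapping.lookup f i \<noteq> 0} \<subseteq> {i. Poly_Mapping.lookup f i \<noteq> 0}"
    by auto
  then have "finite {i. c *\<^sub>R Poly_Mapping.lookup f i \<noteq> 0}"
    by (rule finite_subset) simp
  then show ?thesis
    by (simp add: scaleR_poly_mapping_def)
qed

lemma finite_coeff_index: "finite (coeff_index d)"
proof (rule finite_subset)
  show "coeff_index d \<subseteq> {..d} \<times> {..d}"
    by (auto simp: coeff_index_def)
qed simp

lemma coeff_space_iff:
  "v \<in> coeff_space d \<longleftrightarrow>
     (\<forall>m. m \<notin> coeff_index d \<longrightarrow> Poly_Mapping.lookup (fst v) m = 0 \<and> Poly_Mapping.lookup (snd v) m = 0)"
  by (cases v) (auto simp: coeff_space_def in_keys_iff)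

lemma subspace_coeff_space: "subspace (coeff_space d)"
  by (simp add: subspace_def coeff_space_iff lookup_add lookup_scaleR)

lemma coeff_inner_eq_sum:
  assumes "finite S" "Poly_Mapping.keys (fst u) \<subseteq> S" "Poly_Mapping.keys (snd u) \<subseteq> S"
  shows "coeff_inner u v =
    (\<Sum>m\<in>S. Poly_Mapping.lookup (fst u) m * Poly_Mapping.lookup (fst v) m
            + Poly_Mapping.lookup (snd u) m * Poly_Mapping.lookup (snd v) m)"
  unfolding coeff_inner_def sum.distrib
  by (intro arg_cong2[where f="(+)"] sum.mono_neutral_left) (use assms in \<open>auto simp: in_keys_iff\<close>)

lemma coeff_inner_coeff_space:
  assumes "u \<in> coeff_space d"
  shows "coeff_inner u v =
    (\<Sum>m\<in>coeff_index d. Poly_Mapping.lookup (fst u) m * Poly_Mapping.lookup (fst v) m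
            + Poly_Mapping.lookup (snd u) m * Poly_Mapping.lookup (snd v) m)"
  using assms by (intro coeff_inner_eq_sum finite_coeff_index) (auto simp: coeff_space_def)

lemma coeff_inner_add_left: "coeff_inner (u + u') v = coeff_inner u v + coeff_inner u' v"
proof -
  \<comment> \<open>\<open>coeff_inner\<close> sums over the support of its left argument, and the
    support of \<open>u + u'\<close> may be smaller than those of \<open>u\<close> and
    \<open>u'\<close>. One finite set containing all three supports makes the sums
    comparable.\<close>
  let ?S = "\<Union>w\<in>{u, u', u + u'}. Poly_Mapping.keys (fst w) \<union> Poly_Mapping.keys (snd w)"
  have "coeff_inner w v =
    (\<Sum>m\<in>?S. Poly_Mapping.lookup (fst w) m * Poly_Mapping.lookup (fst v) m
            + Poly_Mapping.lookup (snd w) m * Poly_Mapping.lookup (snd v) m)" if "w \<in> {u, u', u + u'}" for w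
    by (rule coeff_inner_eq_sum) (use that in auto)
  then show ?thesis
    by (simp add: lookup_add sum.distrib algebra_simps del: UN_insert)
qed

lemma coeff_inner_scaleR_left: "coeff_inner (c *\<^sub>R u) v = c * coeff_inner u v"
proof -
  let ?S = "\<Union>w\<in>{u, c *\<^sub>R u}. Poly_Mapping.keys (fst w) \<union> Poly_Mapping.keys (snd w)"
  have "coeff_inner w v =
    (\<Sum>m\<in>?S. Poly_Mapping.lookup (fst w) m * Poly_Mapping.lookup (fst v) m
            + Poly_Mapping.lookup (snd w) m * Poly_Mapping.lookup (snd v) m)" if "w \<in> {u, c *\<^sub>R u}" for w
    by (rule coeff_inner_eq_sum) (use that in auto)
  then show ?thesis
    by (simp add: lookup_scaleR sum_distrib_left algebra_simps del: UN_insert)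
qed

lemma coeff_inner_commute: "coeff_inner u v = coeff_inner v u"
proof -
  let ?S = "\<Union>w\<in>{u, v}. Poly_Mapping.keys (fst w) \<union> Poly_Mapping.keys (snd w)"
  have "coeff_inner u v =
    (\<Sum>m\<in>?S. Poly_Mapping.lookup (fst u) m * Poly_Mapping.lookup (fst v) m
            + Poly_Mapping.lookup (snd u) m * Poly_Mapping.lookup (snd v) m)"
    by (rule coeff_inner_eq_sum) auto
  moreover have "coeff_inner v u =
    (\<Sum>m\<in>?S. Poly_Mapping.lookup (fst v) m * Poly_Mapping.lookup (fst u) m
            + Poly_Mapping.lookup (snd v) m * Poly_Mapping.lookup (snd u) m)"
    by (rule coeff_inner_eq_sum) auto
  ultimately show ?thesis
    by (simp add: mult.commute)
qed

lemma coeff_inner_zero_left: "coeff_inner 0 v = 0"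
  using coeff_inner_scaleR_left[of 0 0 v] by simp

lemma coeff_inner_sum_left: "coeff_inner (\<Sum>i\<in>I. f i) v = (\<Sum>i\<in>I. coeff_inner (f i) v)"
  by (induction I rule: infinite_finite_induct) (auto simp: coeff_inner_zero_left coeff_inner_add_left)

lemma coeff_inner_self_nonneg: "0 \<le> coeff_inner u u"
  unfolding coeff_inner_def by (intro add_nonneg_nonneg sum_nonneg) auto

lemma coeff_inner_self_eq_0: "coeff_inner u u = 0 \<longleftrightarrow> u = 0"
proof
  let ?f = "\<lambda>g :: (nat \<times> nat) \<Rightarrow>\<^sub>0 real. \<Sum>m \<in> Poly_Mapping.keys g. Poly_Mapping.lookup g m * Poly_Mapping.lookup g m"
  have keys: "Poly_Mapping.keys g = {}" if "?f g = 0" for g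
    using that by (simp add: sum_nonneg_eq_0_iff in_keys_iff set_eq_iff del: keys_eq_empty)
  have nn: "?f g \<ge> 0" for g
    by (intro sum_nonneg) simp
  assume *: "coeff_inner u u = 0"
  then have "?f (fst u) = 0 \<and> ?f (snd u) = 0"
    using nn[of "fst u"] nn[of "snd u"] unfolding coeff_inner_def by linarith
  then have "Poly_Mapping.keys (fst u) = {}" "Poly_Mapping.keys (snd u) = {}"
    using keys by blast+
  then show "u = 0"
    by (simp add: prod_eq_iff)
qed (simp add: coeff_inner_zero_left)

section \<open>Frames of affine hulls\<close>

definition orthonormal_system :: "coeffs set \<Rightarrow> nat \<Rightarrow> (nat \<Rightarrow> coeffs) \<Rightarrow> bool" where
  "orthonormal_system L n e \<longleftrightarrow>
     (\<forall>i<n. e i \<in> L) \<and> (\<forall>i<n. \<forall>j<n. coeff_inner (e i) (e j) = (if i = j then 1 else 0))"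

text \<open>The bound has two uses: it makes a system of maximal length exist, and it bounds the
  dimension of the affine hull of \<open>V\<close> by \<open>s\<close>, whence a factor quadratic in
  \<open>d\<close> in the slab estimate.\<close>

lemma orthonormal_system_length_le:
  assumes "orthonormal_system (coeff_space d) n e"
  shows "n \<le> d * (d + 3)"
proof -
  have on: "coeff_inner (e i) (e j) = (if i = j then 1 else 0)" if "i < n" "j < n" for i j
    using assms that by (auto simp: orthonormal_system_def)
  have inj: "inj_on e {..<n}"
    by (rule inj_onI) (metis lessThan_iff on zero_neq_one)
  have indep: "independent (e ` {..<n})"
  proof (rule independent_if_scalars_zero)
    fix f x assume 0: "(\<Sum>x\<in>e ` {..<n}. f x *\<^sub>R x) = 0" and "x \<in> e ` {..<n}"
    then obtain i where i: "i < n" "x = e i" by auto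
    have "0 = coeff_inner (\<Sum>x\<in>e ` {..<n}. f x *\<^sub>R x) (e i)"
      using 0 by (simp add: coeff_inner_zero_left)
    also have "\<dots> = (\<Sum>j<n. f (e j) * coeff_inner (e j) (e i))"
      by (simp add: sum.reindex[OF inj] coeff_inner_sum_left coeff_inner_scaleR_left)
    also have "\<dots> = (\<Sum>j<n. if j = i then f (e i) else 0)"
      by (intro sum.cong) (use i in \<open>auto simp: on\<close>)
    also have "\<dots> = f x"
      using i by simp
    finally show "f x = 0" by simp
  qed simp
  \<comment> \<open>The standard basis of \<open>coeff_space d\<close>: one unit vector for each
    coefficient of \<open>F\<close> and of \<open>G\<close>.\<close>
  define B :: "coeffs set" where "B = (\<lambda>m. (Poly_Mapping.single m 1, 0)) ` coeff_index d \<union>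
      (\<lambda>m. (0, Poly_Mapping.single m 1)) ` coeff_index d"
  have finB: "finite B"
    using finite_coeff_index by (simp add: B_def)
  have "coeff_space d \<subseteq> span B"
  proof
    fix v assume v: "v \<in> coeff_space d"
    let ?w = "\<Sum>m\<in>coeff_index d. Poly_Mapping.lookup (fst v) m *\<^sub>R (Poly_Mapping.single m 1, 0)
                + Poly_Mapping.lookup (snd v) m *\<^sub>R (0, Poly_Mapping.single m 1)"
    have "v = ?w"
      using v finite_coeff_index[of d] unfolding coeff_space_iff
      by (auto intro!: prod_eqI poly_mapping_eqI
          simp: fst_sum snd_sum lookup_sum lookup_scaleR lookup_single when_def if_distrib sum.delta cong: if_cong)
    moreover have "?w \<in> span B"
      by (intro span_sum span_add span_scale span_base) (auto simp: B_def)
    ultimately show "v \<in> span B" by simp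
  qed
  then have "e ` {..<n} \<subseteq> span B"
    using assms by (auto simp: orthonormal_system_def)
  then have "card (e ` {..<n}) \<le> card B"
    using independent_span_bound[OF finB indep] by blast
  also have "card B \<le> card (coeff_index d) + card (coeff_index d)"
    unfolding B_def by (intro order_trans[OF card_Un_le] add_mono card_image_le finite_coeff_index)
  also have "\<dots> = d * (d + 3)"
    using card_coeff_index[of d] by simp
  finally show ?thesis
    by (simp add: card_image[OF inj])
qed

lemma frame_directions:
  assumes "frame A n p e" "affine A" "A \<subseteq> coeff_space d"
  shows "orthonormal_system (coeff_space d) n e"
proof -
  have A: "A = range (\<lambda>x :: nat \<Rightarrow> real. p + (\<Sum>i<n. x i *\<^sub>R e i))"
    using assms by (simp add: frame_def)
  have "e i \<in> coeff_space d" if "i < n" for i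
  proof -
    have "p + (\<Sum>j<n. (0::real) *\<^sub>R e j) \<in> A"
      unfolding A by (rule rangeI)
    moreover have "p + (\<Sum>j<n. (if j = i then 1 else 0 :: real) *\<^sub>R e j) \<in> A"
      unfolding A by (rule rangeI)
    ultimately have "p \<in> coeff_space d" "p + e i \<in> coeff_space d"
      using assms(3) that by (auto simp: if_distrib[of "\<lambda>c. c *\<^sub>R _"] cong: if_cong)
    then show ?thesis
      using subspace_diff[OF subspace_coeff_space, of "p + e i" d p] by simp
  qed
  then show ?thesis
    using assms by (auto simp: orthonormal_system_def frame_def)
qed

text \<open>A system of maximal length spans: if the orthogonal expansion missed some
  \<open>u\<close> in \<open>L\<close>, its normalized residual would be one more orthonormal
  vector, as in a Gram-Schmidt step.\<close>

lemma orthonormal_system_exists_spanning: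
  assumes L: "subspace L" "L \<subseteq> coeff_space d"
  obtains n e where "orthonormal_system L n e" "\<And>u. u \<in> L \<Longrightarrow> u = (\<Sum>i<n. coeff_inner u (e i) *\<^sub>R e i)"
proof -
  let ?P = "\<lambda>n. \<exists>e. orthonormal_system L n e"
  have P0: "?P 0"
    by (simp add: orthonormal_system_def)
  have bound: "n \<le> d * (d + 3)" if P: "?P n" for n
  proof -
    from P obtain e where "orthonormal_system L n e" ..
    then have "orthonormal_system (coeff_space d) n e"
      using L by (auto simp: orthonormal_system_def)
    then show ?thesis
      by (rule orthonormal_system_length_le)
  qed
  have P: "?P (GREATEST n. ?P n)"
    by (rule GreatestI_nat[of ?P, OF P0 bound])
  have max: "n \<le> (GREATEST n. ?P n)" if "?P n" for n
    by (rule Greatest_le_nat[of ?P, OF that bound])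
  define n where "n = (GREATEST n. ?P n)"
  obtain e where e: "orthonormal_system L n e"
    using P by (auto simp: n_def)
  have "u = (\<Sum>i<n. coeff_inner u (e i) *\<^sub>R e i)" if u: "u \<in> L" for u
  proof (rule ccontr)
    assume neq: "u \<noteq> (\<Sum>i<n. coeff_inner u (e i) *\<^sub>R e i)"
    define w where "w = u - (\<Sum>i<n. coeff_inner u (e i) *\<^sub>R e i)"
    define c where "c = coeff_inner w w"
    have c: "c > 0"
      using neq coeff_inner_self_nonneg[of w] coeff_inner_self_eq_0[of w] by (auto simp: c_def w_def)
    have wL: "w \<in> L"
      unfolding w_def using e
      by (intro subspace_diff subspace_sum subspace_scale L u) (auto simp: orthonormal_system_def)
    have w: "w = u + (-1) *\<^sub>R (\<Sum>i<n. coeff_inner u (e i) *\<^sub>R e i)"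
      by (simp add: w_def)
    have we: "coeff_inner w (e j) = 0" if j: "j < n" for j
    proof -
      have "coeff_inner w (e j) = coeff_inner u (e j) - (\<Sum>i<n. coeff_inner u (e i) * coeff_inner (e i) (e j))"
        unfolding w coeff_inner_add_left coeff_inner_scaleR_left coeff_inner_sum_left by simp
      also have "(\<Sum>i<n. coeff_inner u (e i) * coeff_inner (e i) (e j)) = (\<Sum>i<n. if i = j then coeff_inner u (e j) else 0)"
        by (intro sum.cong) (use e j in \<open>auto simp: orthonormal_system_def\<close>)
      finally show ?thesis using j by simp
    qed
    let ?e = "e(n := (1 / sqrt c) *\<^sub>R w)"
    have "orthonormal_system L (Suc n) ?e"
      unfolding orthonormal_system_def
    proof (intro conjI allI impI)
      fix i assume "i < Suc n" then show "?e i \<in> L"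
        using e wL L by (auto simp: orthonormal_system_def less_Suc_eq subspace_scale)
    next
      fix i j assume "i < Suc n" "j < Suc n"
      moreover have "coeff_inner ((1 / sqrt c) *\<^sub>R w) ((1 / sqrt c) *\<^sub>R w) = 1"
        using c by (simp add: coeff_inner_scaleR_left coeff_inner_commute[of w "_ *\<^sub>R w"] flip: c_def)
      moreover have "coeff_inner ((1 / sqrt c) *\<^sub>R w) (e j) = 0" "coeff_inner (e j) ((1 / sqrt c) *\<^sub>R w) = 0"
        if "j < n" for j
        using that we coeff_inner_commute[of "e j"] by (simp_all add: coeff_inner_scaleR_left)
      ultimately show "coeff_inner (?e i) (?e j) = (if i = j then 1 else 0)"
        using e by (auto simp: orthonormal_system_def less_Suc_eq)
    qed
    then have "Suc n \<le> n"
      using max unfolding n_def by blast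
    then show False by simp
  qed
  with e show ?thesis using that by blast
qed

lemma frame_exists:
  assumes "affine A" "A \<subseteq> coeff_space d" "A \<noteq> {}"
  shows "\<exists>n p e. frame A n p e"
proof -
  obtain p where p: "p \<in> A"
    using assms by auto
  define L where "L = (\<lambda>x. x - p) ` A"
  have L: "subspace L"
    unfolding L_def using affine_diffs_subspace_subtract[OF assms(1) p] .
  have Ls: "L \<subseteq> coeff_space d"
    unfolding L_def using assms(2) p by (blast intro: subspace_diff[OF subspace_coeff_space])
  obtain n e where e: "orthonormal_system L n e" "\<And>u. u \<in> L \<Longrightarrow> u = (\<Sum>i<n. coeff_inner u (e i) *\<^sub>R e i)"
    by (rule orthonormal_system_exists_spanning[OF L Ls]) blast
  have "A = range (\<lambda>x :: nat \<Rightarrow> real. p + (\<Sum>i<n. x i *\<^sub>R e i))"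
  proof (intro equalityI subsetI)
    fix a assume "a \<in> A"
    then have "a - p \<in> L" by (auto simp: L_def)
    then have "a = p + (\<Sum>i<n. coeff_inner (a - p) (e i) *\<^sub>R e i)"
      using e(2)[of "a - p"] by (simp add: algebra_simps)
    then show "a \<in> range (\<lambda>x :: nat \<Rightarrow> real. p + (\<Sum>i<n. x i *\<^sub>R e i))"
      by (rule range_eqI[where x="\<lambda>i. coeff_inner (a - p) (e i)"])
  next
    fix b assume "b \<in> range (\<lambda>x :: nat \<Rightarrow> real. p + (\<Sum>i<n. x i *\<^sub>R e i))"
    then obtain x :: "nat \<Rightarrow> real" where x: "b = p + (\<Sum>i<n. x i *\<^sub>R e i)"
      by blast
    have "(\<Sum>i<n. x i *\<^sub>R e i) \<in> L"
      using e(1) by (intro subspace_sum subspace_scale L) (auto simp: orthonormal_system_def)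
    then obtain a where "a \<in> A" "(\<Sum>i<n. x i *\<^sub>R e i) = a - p"
      unfolding L_def by blast
    then show "b \<in> A"
      by (simp add: x)
  qed
  then have "frame A n p e"
    using e(1) unfolding frame_def orthonormal_system_def by blast
  then show ?thesis by blast
qed

text \<open>Existence of a frame ensures that the \<open>SOME\<close> in \<open>hull_measure\<close>
  picks one. A single frame serves all \<open>E\<close>, so measures of different subsets can be
  compared in the same coordinates.\<close>

lemma hull_measure_frame:
  assumes "V \<subseteq> coeff_space d" "V \<noteq> {}"
  obtains n p e where "frame (affine hull V) n p e" "n \<le> d * (d + 3)"
    "\<And>E. hull_measure V E = outer_measure_of (\<Pi>\<^sub>M i\<in>{..<n}. lborel)
          {x \<in> {..<n} \<rightarrow>\<^sub>E UNIV. p + (\<Sum>i<n. x i *\<^sub>R e i) \<in> E}"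
proof -
  have sub: "affine hull V \<subseteq> coeff_space d"
    using assms subspace_coeff_space by (intro hull_minimal subspace_imp_affine)
  obtain n p e where npe: "(SOME (n, p, e). frame (affine hull V) n p e) = (n, p, e)"
    by (metis prod_cases3)
  have "\<exists>x. case x of (n, p, e) \<Rightarrow> frame (affine hull V) n p e"
    using frame_exists[OF affine_affine_hull sub] assms by auto
  from someI_ex[OF this] have "frame (affine hull V) n p e"
    unfolding npe by simp
  moreover from this have "n \<le> d * (d + 3)"
    using frame_directions[OF _ affine_affine_hull sub] orthonormal_system_length_le by blast
  ultimately show ?thesis
    using that by (simp add: hull_measure_def npe)
qed

section \<open>Slabs of convex sets\<close>

abbreviation lborel_n :: "nat \<Rightarrow> (nat \<Rightarrow> real) measure" where
  "lborel_n n \<equiv> \<Pi>\<^sub>M i\<in>{..<n}. lborel"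

text \<open>Centre \<open>y\<close>, ratio \<open>c\<close>. The restriction to
  \<open>{..<n}\<close> keeps the value among the extensional functions that form the space of
  \<open>lborel_n n\<close>.\<close>

definition homothety :: "nat \<Rightarrow> real \<Rightarrow> (nat \<Rightarrow> real) \<Rightarrow> (nat \<Rightarrow> real) \<Rightarrow> nat \<Rightarrow> real" where
  "homothety n c y x = (\<lambda>i\<in>{..<n}. (1 - c) * y i + c * x i)"

lemma homothety_measurable [measurable]: "homothety n c y \<in> lborel_n n \<rightarrow>\<^sub>M lborel_n n"
  unfolding homothety_def by measurable

lemma emeasure_lborel_affine_vimage:
  assumes "c > 0" "A \<in> sets lborel"
  shows "ennreal c * emeasure lborel ((\<lambda>x::real. t + c * x) -` A) = emeasure lborel A"
proof -
  have "emeasure lborel A = (\<integral>\<^sup>+x. indicator A x \<partial>lborel)"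
    using assms by simp
  also have "\<dots> = ennreal c * (\<integral>\<^sup>+x. indicator A (t + c * x) \<partial>lborel)"
    using assms by (subst nn_integral_real_affine[of _ c t]) auto
  also have "(\<lambda>x. indicator A (t + c * x) :: ennreal) = indicator ((\<lambda>x::real. t + c * x) -` A)"
    by (auto simp: indicator_def)
  also have "(\<integral>\<^sup>+x. indicator ((\<lambda>x::real. t + c * x) -` A) x \<partial>lborel) = emeasure lborel ((\<lambda>x::real. t + c * x) -` A)"
  proof (rule nn_integral_indicator)
    have "(\<lambda>x::real. t + c * x) -` A \<inter> space lborel \<in> sets lborel"
      using assms(2) by (intro measurable_sets[where A=lborel]) auto
    then show "(\<lambda>x::real. t + c * x) -` A \<in> sets lborel" by simp
  qed
  finally show ?thesis by simp
qed

text \<open>A finite product measure is determined by its values on boxes, and there the map acts on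
  each coordinate separately, so each of the \<open>n\<close> coordinates contributes one factor
  \<open>c\<close>.\<close>

lemma lborel_n_homothety:
  assumes c: "c > 0"
  shows "scale_measure (ennreal (c ^ n)) (distr (lborel_n n) (lborel_n n) (homothety n c y)) = lborel_n n"
proof -
  interpret product_sigma_finite "\<lambda>_::nat. lborel :: real measure"
    by standard
  show ?thesis
  proof (rule PiM_eqI)
    fix A :: "nat \<Rightarrow> real set" assume A: "\<And>i. i \<in> {..<n} \<Longrightarrow> A i \<in> sets lborel"
    let ?T = "\<lambda>i x. (1 - c) * y i + c * x"
    have vA: "?T i -` A i \<in> sets lborel" if "i < n" for i
    proof -
      have "?T i -` A i \<inter> space lborel \<in> sets lborel"
        using A that by (intro measurable_sets[where A=lborel]) auto
      then show ?thesis by simp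
    qed
    have "homothety n c y -` (Pi\<^sub>E {..<n} A) \<inter> space (lborel_n n) = Pi\<^sub>E {..<n} (\<lambda>i. ?T i -` A i)"
      by (auto simp: space_PiM homothety_def PiE_iff)
    then have "emeasure (scale_measure (ennreal (c ^ n)) (distr (lborel_n n) (lborel_n n) (homothety n c y))) (Pi\<^sub>E {..<n} A)
       = ennreal (c ^ n) * emeasure (lborel_n n) (Pi\<^sub>E {..<n} (\<lambda>i. ?T i -` A i))"
      using A by (simp add: emeasure_distr sets_PiM_I_finite)
    also have "\<dots> = ennreal (c ^ n) * (\<Prod>i<n. emeasure lborel (?T i -` A i))"
      using vA by (subst emeasure_PiM) auto
    also have "\<dots> = (\<Prod>i<n. ennreal c * emeasure lborel (?T i -` A i))"
      using c by (simp add: prod.distrib ennreal_power)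
    also have "\<dots> = (\<Prod>i<n. emeasure lborel (A i))"
      using A c by (intro prod.cong emeasure_lborel_affine_vimage) auto
    finally show "emeasure (scale_measure (ennreal (c ^ n)) (distr (lborel_n n) (lborel_n n) (homothety n c y))) (Pi\<^sub>E {..<n} A)
       = (\<Prod>i<n. emeasure lborel (A i))" .
  qed simp_all
qed

text \<open>Every measurable cover of the image pulls back to a measurable cover of
  \<open>S\<close>, and the two measures differ by the factor \<open>c ^ n\<close>. Passing through
  covers leaves \<open>S\<close> free to be non-measurable.\<close>

lemma outer_measure_of_homothety:
  assumes c: "c > 0" and S: "S \<subseteq> space (lborel_n n)"
  shows "ennreal (c ^ n) * outer_measure_of (lborel_n n) S \<le> outer_measure_of (lborel_n n) (homothety n c y ` S)"
  unfolding outer_measure_of_def[of _ "_ ` _"]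
proof (rule INF_greatest)
  fix B assume "B \<in> {B \<in> sets (lborel_n n). homothety n c y ` S \<subseteq> B}"
  then have B: "B \<in> sets (lborel_n n)" "homothety n c y ` S \<subseteq> B" by auto
  let ?B = "homothety n c y -` B \<inter> space (lborel_n n)"
  have "outer_measure_of (lborel_n n) S \<le> emeasure (lborel_n n) ?B"
    unfolding outer_measure_of_def using B S by (intro INF_lower) auto
  then have "ennreal (c ^ n) * outer_measure_of (lborel_n n) S \<le> ennreal (c ^ n) * emeasure (lborel_n n) ?B"
    by (rule mult_left_mono) simp
  also have "\<dots> = emeasure (scale_measure (ennreal (c ^ n)) (distr (lborel_n n) (lborel_n n) (homothety n c y))) B"
    using B by (simp add: emeasure_distr)
  also have "\<dots> = emeasure (lborel_n n) B"
    by (simp add: lborel_n_homothety[OF c])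
  finally show "ennreal (c ^ n) * outer_measure_of (lborel_n n) S \<le> emeasure (lborel_n n) B" .
qed

text \<open>Outer measures are not superadditive on arbitrary disjoint sets; here the disjoint
  measurable sets \<open>B j\<close> separate the pieces \<open>S j\<close>, and any measurable
  cover of \<open>W\<close> can be cut along them.\<close>

lemma sum_outer_measure_of_le:
  assumes "finite J" "\<And>j. j \<in> J \<Longrightarrow> B j \<in> sets M" "disjoint_family_on B J" "\<And>j. j \<in> J \<Longrightarrow> S j \<subseteq> W \<inter> B j"
  shows "(\<Sum>j\<in>J. outer_measure_of M (S j)) \<le> outer_measure_of M W"
  unfolding outer_measure_of_def[of _ W]
proof (rule INF_greatest)
  fix A assume A: "A \<in> {B \<in> sets M. W \<subseteq> B}"
  have "(\<Sum>j\<in>J. outer_measure_of M (S j)) \<le> (\<Sum>j\<in>J. emeasure M (A \<inter> B j))"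
    unfolding outer_measure_of_def using assms(2,4) A by (intro sum_mono INF_lower) blast
  also have "\<dots> = emeasure M (\<Union>j\<in>J. A \<inter> B j)"
    using assms A by (intro sum_emeasure) (auto simp: disjoint_family_on_def)
  also have "\<dots> \<le> emeasure M A"
    using A by (intro emeasure_mono) auto
  finally show "(\<Sum>j\<in>J. outer_measure_of M (S j)) \<le> emeasure M A" .
qed

text \<open>
  Shrinking the slab part of \<open>W\<close> towards \<open>y\<close> by factors near \<open>1\<close> produces many pairwise disjoint
  subsets of \<open>W\<close>, each of at least half its volume.
\<close>

lemma outer_measure_of_slab_le:
  fixes a :: "nat \<Rightarrow> real" and b :: real and n
  defines "l \<equiv> \<lambda>x. b + (\<Sum>i<n. a i * x i)"
  assumes W: "W \<subseteq> space (lborel_n n)"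
    and conv: "\<And>x c. x \<in> W \<Longrightarrow> 0 \<le> c \<Longrightarrow> c \<le> 1 \<Longrightarrow> homothety n c y x \<in> W"
    and eps: "\<epsilon> > 0" and h: "h > 0" "h \<le> \<bar>l y\<bar>"
  shows "outer_measure_of (lborel_n n) {x \<in> W. \<bar>l x\<bar> \<le> \<epsilon>}
           \<le> ennreal (12 * \<epsilon> * (n + 1) / h) * outer_measure_of (lborel_n n) W"
proof -
  let ?S = "{x \<in> W. \<bar>l x\<bar> \<le> \<epsilon>}"
  let ?m = "outer_measure_of (lborel_n n)"
  define H where "H = \<bar>l y\<bar>"
  have H: "H > 0" "h \<le> H" using h by (auto simp: H_def)
  \<comment> \<open>The copy shrunk by the ratio \<open>1 - r j\<close> lies where \<open>l\<close>
    is within \<open>\<epsilon>\<close> of \<open>r j * l y\<close>. These levels are at least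
    \<open>3 * \<epsilon>\<close> apart, more than the width \<open>2 * \<epsilon>\<close>, so the
    copies are disjoint. For \<open>j < K\<close> the number \<open>r j\<close> is at most
    \<open>1 / (2 * (n + 1))\<close>, and Bernoulli's inequality leaves at least half the volume.
    \<open>Suc\<close> counts the copy \<open>j = 0\<close> and thereby rounds the number of copies
    up.\<close>
  define K where "K = Suc (nat \<lfloor>H / (6 * \<epsilon> * (n + 1))\<rfloor>)"
  define r where "r j = real j * (3 * \<epsilon> / H)" for j
  have K: "real K \<ge> H / (6 * \<epsilon> * (n + 1))"
    unfolding K_def by linarith
  have rK: "r j * (2 * (real n + 1)) \<le> 1" if "j < K" for j
  proof -
    have "0 \<le> H / (6 * \<epsilon> * (n + 1))" using H eps by simp
    then have "real j \<le> H / (6 * \<epsilon> * (n + 1))"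
      using that unfolding K_def by linarith
    then have "real j * (6 * \<epsilon> * (real n + 1)) \<le> H"
      using eps by (simp add: pos_le_divide_eq add.commute)
    then show ?thesis
      using H by (simp add: r_def field_simps)
  qed
  have r0: "r j \<ge> 0" for j
    using H eps by (simp add: r_def)
  have r1: "r j \<le> 1/2" if "j < K" for j
  proof -
    have "r j * 2 * 1 \<le> r j * 2 * (real n + 1)"
      using r0 by (intro mult_left_mono) auto
    also have "\<dots> = r j * (2 * (real n + 1))" by simp
    also have "\<dots> \<le> 1" by (rule rK[OF that])
    finally show ?thesis by simp
  qed
  have pow: "(1 - r j) ^ n \<ge> 1/2" if "j < K" for j
  proof -
    have "1 + real n * (- r j) \<le> (1 + (- r j)) ^ n"
      using r1[OF that] by (intro Bernoulli_inequality) auto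
    moreover have "real n * r j \<le> 1/2"
      using rK[OF that] r0[of j] by (simp add: algebra_simps)
    ultimately show ?thesis by simp
  qed
  have l_hom: "l (homothety n (1 - t) y x) = t * l y + (1 - t) * l x" for t x
    unfolding l_def homothety_def
    by (simp add: algebra_simps sum.distrib sum_distrib_left sum_subtractf)
  define B where "B j = {x \<in> space (lborel_n n). \<bar>l x - r j * l y\<bar> \<le> \<epsilon>}" for j
  have [measurable]: "l \<in> borel_measurable (lborel_n n)"
    unfolding l_def by measurable
  have meas: "B j \<in> sets (lborel_n n)" for j
    unfolding B_def by measurable
  have disj: "disjoint_family_on B {..<K}"
    unfolding disjoint_family_on_def
  proof (intro ballI impI)
    fix i j :: nat assume "i \<noteq> j"
    then have "1 \<le> \<bar>real i - real j\<bar>"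
      by (cases i j rule: linorder_cases) auto
    then have "1 * (3 * \<epsilon>) \<le> \<bar>real i - real j\<bar> * (3 * \<epsilon>)"
      using eps by (intro mult_right_mono) auto
    also have "\<dots> = \<bar>(r i - r j) * l y\<bar>"
    proof -
      have "r i - r j = (real i - real j) * (3 * \<epsilon> / H)"
        by (simp only: r_def left_diff_distrib)
      then show ?thesis
        using H eps by (simp add: abs_mult flip: H_def)
    qed
    finally have "3 * \<epsilon> \<le> \<bar>r i * l y - r j * l y\<bar>"
      by (simp add: left_diff_distrib)
    then show "B i \<inter> B j = {}"
      using eps unfolding B_def by force
  qed
  have sub: "homothety n (1 - r j) y ` ?S \<subseteq> W \<inter> B j" if "j < K" for j
  proof safe
    fix x assume x: "x \<in> W" "\<bar>l x\<bar> \<le> \<epsilon>"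
    show *: "homothety n (1 - r j) y x \<in> W"
      using x r0[of j] r1[OF that] by (intro conv) auto
    have "\<bar>(1 - r j) * l x\<bar> \<le> 1 * \<epsilon>"
      unfolding abs_mult using x r0[of j] r1[OF that] by (intro mult_mono) auto
    then show "homothety n (1 - r j) y x \<in> B j"
      using * W by (auto simp: B_def l_hom)
  qed
  have "ennreal (real K / 2) * ?m ?S = (\<Sum>j<K. ennreal (1/2) * ?m ?S)"
  proof -
    have "ennreal (real K / 2) = ennreal (real K) * ennreal (1/2)"
      by (subst ennreal_mult[symmetric]) auto
    then show ?thesis
      by (simp add: ennreal_of_nat_eq_real_of_nat mult.assoc del: ennreal_half)
  qed
  also have "\<dots> \<le> (\<Sum>j<K. ?m (homothety n (1 - r j) y ` ?S))"
  proof (rule sum_mono)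
    fix j assume "j \<in> {..<K}"
    then have j: "j < K" by simp
    have "ennreal (1/2) * ?m ?S \<le> ennreal ((1 - r j) ^ n) * ?m ?S"
      using pow[OF j] by (intro mult_right_mono ennreal_leI) auto
    also have "\<dots> \<le> ?m (homothety n (1 - r j) y ` ?S)"
      using r1[OF j] W by (intro outer_measure_of_homothety) auto
    finally show "ennreal (1/2) * ?m ?S \<le> ?m (homothety n (1 - r j) y ` ?S)" .
  qed
  also have "\<dots> \<le> ?m W"
    using meas disj sub by (intro sum_outer_measure_of_le[where B=B]) auto
  finally have le: "ennreal (real K / 2) * ?m ?S \<le> ?m W" .
  \<comment> \<open>The 12 is the 6 from the definition of \<open>K\<close> times the 2 lost by
    halving the volume.\<close>
  have "1 \<le> (12 * \<epsilon> * (n + 1) / H) * (real K / 2)"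
  proof -
    have "H \<le> real K * (6 * \<epsilon> * (n + 1))"
      using K eps by (simp add: pos_divide_le_eq)
    also have "\<dots> = ((12 * \<epsilon> * (n + 1)) * (real K / 2))"
      by simp
    finally show ?thesis
      using H by simp
  qed
  also have "\<dots> \<le> (12 * \<epsilon> * (n + 1) / h) * (real K / 2)"
    using H h eps by (intro mult_right_mono divide_left_mono) auto
  finally have 1: "1 \<le> (12 * \<epsilon> * (n + 1) / h) * (real K / 2)" .
  have "?m ?S = ennreal 1 * ?m ?S" by simp
  also have "\<dots> \<le> ennreal ((12 * \<epsilon> * (n + 1) / h) * (real K / 2)) * ?m ?S"
    using 1 by (intro mult_right_mono ennreal_leI) auto
  also have "\<dots> = ennreal (12 * \<epsilon> * (n + 1) / h) * (ennreal (real K / 2) * ?m ?S)"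
    using eps h by (subst ennreal_mult) (auto simp: mult.assoc)
  also have "\<dots> \<le> ennreal (12 * \<epsilon> * (n + 1) / h) * ?m W"
    using le by (intro mult_left_mono) auto
  finally show ?thesis .
qed

section \<open>Volumes in dimension four: the projection hypothesis forces a point of large
  trace\<close>

lemma inverse_antimono_ennreal: "x \<le> y \<Longrightarrow> inverse y \<le> inverse (x :: ennreal)"
  by (simp add: less_eq_ennreal.rep_eq inverse_ennreal.rep_eq ereal_inverse_antimono)

text \<open>In dimension four a cube of side \<open>N\<close> has half-diagonal \<open>N\<close>, so
  the open cube fits into the open ball.\<close>

lemma emeasure_ball_ge:
  assumes "N > 0"
  shows "ennreal (N ^ 4) \<le> emeasure lebesgue (ball (0 :: real ^ 4) N)"
proof -
  let ?Q = "box (\<chi> i. - N / 2) (\<chi> i. N / 2) :: (real ^ 4) set"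
  have "?Q \<subseteq> ball 0 N"
  proof
    fix x :: "real ^ 4" assume "x \<in> ?Q"
    then have "\<bar>x $ i\<bar> < N / 2" for i
      by (auto simp: mem_box_cart abs_less_iff dest!: spec[of _ i])
    then have "(x $ i)\<^sup>2 < (N / 2)\<^sup>2" for i
      using assms by (intro power2_strict_mono) auto
    from this[of 1] this[of 2] this[of 3] this[of 4] have "(norm x)\<^sup>2 < 4 * (N / 2)\<^sup>2"
      unfolding norm_vec_def L2_set_def by (simp add: sum_4 sum_nonneg)
    then have "(norm x)\<^sup>2 < N\<^sup>2" by (simp add: power_divide)
    then show "x \<in> ball 0 N"
      using assms by (simp add: power2_less_imp_less)
  qed
  then have "emeasure lebesgue ?Q \<le> emeasure lebesgue (ball (0 :: real ^ 4) N)"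
    by (intro emeasure_mono) auto
  moreover have "emeasure lebesgue ?Q = ennreal (N ^ 4)"
  proof -
    have "emeasure lebesgue ?Q = emeasure lborel ?Q" by simp
    also have "\<dots> = ennreal (\<Prod>b\<in>Basis. ((\<chi> i. N / 2) - (\<chi> i. - N / 2) :: real ^ 4) \<bullet> b)"
      using assms by (intro emeasure_lborel_box) (auto simp: Basis_vec_def inner_axis)
    also have "(\<Prod>b\<in>Basis. ((\<chi> i. N / 2) - (\<chi> i. - N / 2) :: real ^ 4) \<bullet> b) = (\<Prod>b\<in>(Basis::(real^4) set). N)"
      by (intro prod.cong) (auto simp: Basis_vec_def inner_axis)
    also have "\<dots> = N ^ 4" by simp
    finally show ?thesis .
  qed
  ultimately show ?thesis by simp
qed

text \<open>The set is the image of a box with half-sides \<open>N\<close>, \<open>N\<close>,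
  \<open>N\<close>, \<open>h\<close> under a shear, which has determinant 1.\<close>

lemma emeasure_sheared_box_le:
  assumes "N > 0" "h > 0"
  shows "{x :: real ^ 4. \<bar>x $ 1\<bar> \<le> N \<and> \<bar>x $ 2\<bar> \<le> N \<and> \<bar>x $ 3\<bar> \<le> N \<and> \<bar>x $ 1 + x $ 4\<bar> \<le> h} \<in> sets lebesgue" (is "?T \<in> _")
    and "emeasure lebesgue {x :: real ^ 4. \<bar>x $ 1\<bar> \<le> N \<and> \<bar>x $ 2\<bar> \<le> N \<and> \<bar>x $ 3\<bar> \<le> N \<and> \<bar>x $ 1 + x $ 4\<bar> \<le> h} = ennreal (16 * N ^ 3 * h)"
proof -
  define f :: "real ^ 4 \<Rightarrow> real ^ 4" where "f x = (\<chi> i. if i = 4 then x $ 4 - x $ 1 else x $ i)" for x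
  define u :: "real ^ 4" where "u = (\<chi> i. if i = 4 then h else N)"
  have lin: "linear f"
    unfolding f_def by (rule linearI) (auto simp: vec_eq_iff algebra_simps)
  have T: "?T = f ` cbox (- u) u"
  proof safe
    fix x :: "real ^ 4" assume x: "\<bar>x $ 1\<bar> \<le> N" "\<bar>x $ 2\<bar> \<le> N" "\<bar>x $ 3\<bar> \<le> N" "\<bar>x $ 1 + x $ 4\<bar> \<le> h"
    let ?y = "(\<chi> i. if i = 4 then x $ 4 + x $ 1 else x $ i) :: real ^ 4"
    have "x = f ?y"
      by (simp add: f_def vec_eq_iff)
    moreover have "?y \<in> cbox (- u) u"
      using x by (auto simp: mem_box_cart u_def forall_4 abs_le_iff algebra_simps)
    ultimately show "x \<in> f ` cbox (- u) u" by blast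
  next
    fix y assume y: "y \<in> cbox (- u) u"
    then show "\<bar>f y $ 1\<bar> \<le> N" "\<bar>f y $ 2\<bar> \<le> N" "\<bar>f y $ 3\<bar> \<le> N" "\<bar>f y $ 1 + f y $ 4\<bar> \<le> h"
      by (auto simp: mem_box_cart u_def forall_4 f_def abs_le_iff)
  qed
  \<comment> \<open>\<open>4 = 0\<close> is the least element of the index type \<open>4\<close>.\<close>
  have less: "\<not> (1 :: 4) < 4"
    by (simp add: less_bit0_def bit0.Rep_numeral bit0.Rep_1)
  have det: "det (matrix f) = 1"
  proof -
    have "det (matrix f) = (\<Prod>i\<in>UNIV. matrix f $ i $ i)"
      by (rule det_upperdiagonal) (use less in \<open>auto simp: matrix_def f_def axis_def\<close>)
    also have "\<dots> = 1"
      by (intro prod.neutral) (auto simp: matrix_def f_def axis_def)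
    finally show ?thesis .
  qed
  have lm: "?T \<in> lmeasurable"
    unfolding T by (intro measurable_linear_image lin) auto
  then show "?T \<in> sets lebesgue" by (rule fmeasurableD)
  have "measure lebesgue ?T = measure lebesgue (cbox (- u) u)"
    unfolding T by (subst measure_linear_image[OF lin]) (auto simp: det)
  also have "\<dots> = (\<Prod>i\<in>UNIV. u $ i - (- u) $ i)"
  proof -
    have "\<forall>i. (- u) $ i \<le> u $ i"
      using assms by (simp add: u_def)
    then have "cbox (- u) u \<noteq> {}"
      by (simp add: interval_ne_empty_cart)
    then show ?thesis
      by (subst measure_completion) (simp_all add: content_cbox_cart)
  qed
  also have "\<dots> = (2 * N) * (2 * N) * (2 * N) * (2 * h)"
    by (simp only: UNIV_4) (simp add: u_def)
  also have "\<dots> = 16 * N ^ 3 * h"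
    by (simp add: power3_eq_cube)
  finally show "emeasure lebesgue ?T = ennreal (16 * N ^ 3 * h)"
    using lm by (simp add: emeasure_eq_measure2)
qed

text \<open>Otherwise \<open>P\<close> fits into the sheared box of volume
  \<open>16 * N ^ 3 * h\<close>. For \<open>h = N / (32 * \<delta>)\<close> this is
  \<open>N ^ 4 / (2 * \<delta>)\<close>, and the ball, of volume at least \<open>N ^ 4\<close>,
  would give a ratio of at least \<open>2 * \<delta>\<close>.\<close>

lemma exists_wide_point:
  fixes P :: "(real ^ 4) set"
  assumes N: "N > 0" and \<delta>: "\<delta> > 0" and P: "\<And>x i. x \<in> P \<Longrightarrow> \<bar>x $ i\<bar> \<le> N"
    and ratio: "emeasure lebesgue (ball (0 :: real ^ 4) N) / emeasure lebesgue P \<le> ennreal \<delta>"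
  shows "\<exists>x\<in>P. N / (32 * \<delta>) \<le> \<bar>x $ 1 + x $ 4\<bar>"
proof (rule ccontr)
  assume "\<not> ?thesis"
  then have small: "\<bar>x $ 1 + x $ 4\<bar> \<le> N / (32 * \<delta>)" if "x \<in> P" for x
    using that by force
  let ?h = "N / (32 * \<delta>)"
  let ?T = "{x :: real ^ 4. \<bar>x $ 1\<bar> \<le> N \<and> \<bar>x $ 2\<bar> \<le> N \<and> \<bar>x $ 3\<bar> \<le> N \<and> \<bar>x $ 1 + x $ 4\<bar> \<le> ?h}"
  have h: "?h > 0" using N \<delta> by simp
  \<comment> \<open>A non-measurable \<open>P\<close> would get measure 0 by default; monotonicity
    asks for measurability of the larger set only, so the step covers this case too.\<close>
  have "emeasure lebesgue P \<le> emeasure lebesgue ?T"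
    using P small emeasure_sheared_box_le(1)[OF N h] by (intro emeasure_mono) auto
  also have "\<dots> = ennreal (N ^ 4 / (2 * \<delta>))"
    by (subst emeasure_sheared_box_le(2)[OF N h]) (simp add: eval_nat_numeral)
  finally have le: "emeasure lebesgue P \<le> ennreal (N ^ 4 / (2 * \<delta>))" .
  have "ennreal (2 * \<delta>) = ennreal (N ^ 4) / ennreal (N ^ 4 / (2 * \<delta>))"
    using N \<delta> by (subst divide_ennreal) auto
  also have "\<dots> \<le> emeasure lebesgue (ball (0 :: real ^ 4) N) / ennreal (N ^ 4 / (2 * \<delta>))"
    by (intro divide_right_mono_ennreal emeasure_ball_ge N)
  also have "\<dots> \<le> emeasure lebesgue (ball (0 :: real ^ 4) N) / emeasure lebesgue P"
    unfolding divide_ennreal_def using le by (intro mult_left_mono inverse_antimono_ennreal) auto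
  also have "\<dots> \<le> ennreal \<delta>" by (rule ratio)
  finally show False
    using \<delta> by (simp add: ennreal_le_iff)
qed

section \<open>The trace functional on \<open>V\<close> and its slabs\<close>

definition coeff_trace :: "coeffs \<Rightarrow> real" where
  "coeff_trace v = Poly_Mapping.lookup (fst v) (1, 0) + Poly_Mapping.lookup (snd v) (0, 1)"

lemma abs_lookup_le_coeff_norm:
  "\<bar>Poly_Mapping.lookup (fst v) m\<bar> \<le> coeff_norm v" "\<bar>Poly_Mapping.lookup (snd v) m\<bar> \<le> coeff_norm v"
proof -
  let ?S = "insert m (Poly_Mapping.keys (fst v) \<union> Poly_Mapping.keys (snd v))"
  let ?f = "\<lambda>m. Poly_Mapping.lookup (fst v) m * Poly_Mapping.lookup (fst v) m
            + Poly_Mapping.lookup (snd v) m * Poly_Mapping.lookup (snd v) m"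
  have eq: "coeff_inner v v = sum ?f ?S"
    by (rule coeff_inner_eq_sum) auto
  have "?f m \<le> coeff_inner v v"
    unfolding eq by (rule member_le_sum) auto
  then have "(Poly_Mapping.lookup (fst v) m)\<^sup>2 \<le> coeff_inner v v" "(Poly_Mapping.lookup (snd v) m)\<^sup>2 \<le> coeff_inner v v"
    by (auto simp: power2_eq_square intro: order_trans[rotated])
  then show "\<bar>Poly_Mapping.lookup (fst v) m\<bar> \<le> coeff_norm v" "\<bar>Poly_Mapping.lookup (snd v) m\<bar> \<le> coeff_norm v"
    unfolding coeff_norm_def by (auto intro!: real_le_rsqrt)
qed

lemma linear_part_nth:
  "linear_part v $ 1 = Poly_Mapping.lookup (fst v) (1, 0)"
  "linear_part v $ 2 = Poly_Mapping.lookup (fst v) (0, 1)"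
  "linear_part v $ 3 = Poly_Mapping.lookup (snd v) (1, 0)"
  "linear_part v $ 4 = Poly_Mapping.lookup (snd v) (0, 1)"
  by (simp_all add: linear_part_def vector_def)

lemma exists_large_trace:
  assumes N: "N > 0" and \<delta>: "\<delta> > 0" and V: "V \<subseteq> coeff_ball d N"
    and ratio: "emeasure lebesgue (ball (0 :: real ^ 4) N) / emeasure lebesgue (linear_part ` V) \<le> ennreal \<delta>"
  shows "\<exists>v\<in>V. N / (32 * \<delta>) \<le> \<bar>coeff_trace v\<bar>"
proof -
  have "\<bar>linear_part v $ i\<bar> \<le> N" if "v \<in> V" for v i
  proof -
    have v: "coeff_norm v \<le> N"
      using that V by (auto simp: coeff_ball_def)
    have "\<forall>i. \<bar>linear_part v $ i\<bar> \<le> coeff_norm v"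
      unfolding forall_4 linear_part_nth by (intro conjI abs_lookup_le_coeff_norm)
    then show ?thesis
      using v order_trans by blast
  qed
  then have "\<exists>x\<in>linear_part ` V. N / (32 * \<delta>) \<le> \<bar>x $ 1 + x $ 4\<bar>"
    by (intro exists_wide_point[OF N \<delta> _ ratio]) auto
  then show ?thesis
    by (auto simp: linear_part_nth coeff_trace_def)
qed

lemma hull_measure_mono: "E \<subseteq> E' \<Longrightarrow> hull_measure V E \<le> hull_measure V E'"
  unfolding hull_measure_def by (auto split: prod.split intro!: outer_measure_of_mono)

text \<open>In frame coordinates the trace is an affine function and \<open>V\<close> a set closed
  under homotheties towards the coordinates of \<open>v\<close>, so
  \<open>outer_measure_of_slab_le\<close> applies. The dimension \<open>n\<close> of the hull is
  then replaced by its bound \<open>s\<close>.\<close>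

lemma hull_measure_small_trace_le:
  assumes V: "V \<subseteq> coeff_space d" "convex V" and v: "v \<in> V" "h \<le> \<bar>coeff_trace v\<bar>" and h: "h > 0" and eps: "\<epsilon> > 0"
  shows "hull_measure V {v \<in> V. \<bar>coeff_trace v\<bar> \<le> \<epsilon>}
    \<le> ennreal (12 * \<epsilon> * (d * (d + 3) + 1) / h) * hull_measure V V"
proof -
  from v have "V \<noteq> {}" by auto
  from hull_measure_frame[OF V(1) this] obtain n p e where
    fr: "frame (affine hull V) n p e" "n \<le> d * (d + 3)" and
    hm: "\<And>E. hull_measure V E = outer_measure_of (lborel_n n)
          {x \<in> {..<n} \<rightarrow>\<^sub>E UNIV. p + (\<Sum>i<n. x i *\<^sub>R e i) \<in> E}"
    by blast
  let ?E = "\<lambda>x. p + (\<Sum>i<n. x i *\<^sub>R e i)"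
  let ?W = "{x \<in> {..<n} \<rightarrow>\<^sub>E UNIV. ?E x \<in> V}"
  obtain y where y: "v = ?E y"
    using fr(1) hull_inc[OF v(1), of affine] unfolding frame_def by auto
  have tr: "coeff_trace (?E x) = coeff_trace p + (\<Sum>i<n. coeff_trace (e i) * x i)" for x
    by (simp add: coeff_trace_def lookup_add fst_sum snd_sum lookup_sum lookup_scaleR sum.distrib algebra_simps)
  have "outer_measure_of (lborel_n n) {x \<in> ?W. \<bar>coeff_trace p + (\<Sum>i<n. coeff_trace (e i) * x i)\<bar> \<le> \<epsilon>}
           \<le> ennreal (12 * \<epsilon> * (n + 1) / h) * outer_measure_of (lborel_n n) ?W"
  proof (rule outer_measure_of_slab_le[where y=y])
    show "?W \<subseteq> space (lborel_n n)"
      by (auto simp: space_PiM)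
    show "h \<le> \<bar>coeff_trace p + (\<Sum>i<n. coeff_trace (e i) * y i)\<bar>"
      using v(2) by (simp add: y tr)
    fix x c assume x: "x \<in> ?W" and c: "0 \<le> c" "c \<le> (1::real)"
    have "?E (homothety n c y x) = p + (\<Sum>i<n. ((1 - c) * y i + c * x i) *\<^sub>R e i)"
      by (simp add: homothety_def)
    also have "\<dots> = (1 - c) *\<^sub>R ?E y + c *\<^sub>R ?E x"
      by (simp add: scaleR_add_right scaleR_add_left sum.distrib scaleR_sum_right scaleR_left_diff_distrib)
    also have "\<dots> \<in> V"
      using x c v(1) V(2) y by (intro convexD) auto
    finally show "homothety n c y x \<in> ?W"
      by (simp add: homothety_def)
  qed (use eps h in auto)
  also have "{x \<in> ?W. \<bar>coeff_trace p + (\<Sum>i<n. coeff_trace (e i) * x i)\<bar> \<le> \<epsilon>} =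
     {x \<in> {..<n} \<rightarrow>\<^sub>E UNIV. ?E x \<in> {v \<in> V. \<bar>coeff_trace v\<bar> \<le> \<epsilon>}}"
    by (auto simp: tr)
  also have "outer_measure_of (lborel_n n) \<dots> = hull_measure V {v \<in> V. \<bar>coeff_trace v\<bar> \<le> \<epsilon>}"
    by (simp add: hm)
  also have "outer_measure_of (lborel_n n) ?W = hull_measure V V"
    by (simp add: hm)
  also have "ennreal (12 * \<epsilon> * (n + 1) / h) * hull_measure V V
     \<le> ennreal (12 * \<epsilon> * (d * (d + 3) + 1) / h) * hull_measure V V"
  proof -
    have "real (n + 1) \<le> real (d * (d + 3) + 1)"
      using fr(2) by (simp only: of_nat_le_iff)
    then show ?thesis
      using eps h by (intro mult_right_mono ennreal_leI divide_right_mono mult_left_mono) auto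
  qed
  finally show ?thesis .
qed

section \<open>Zeros of bounded holomorphic functions\<close>

text \<open>Division of \<open>f\<close> by the coordinate \<open>z\<close> does not enlarge the sup
  bound; this is the Schwarz lemma, with its derivative part covering the value of the quotient at
  0.\<close>

lemma Schwarz_factor:
  assumes holf: "f holomorphic_on ball 0 1" and f0: "f 0 = 0" and M: "\<And>z. norm z < 1 \<Longrightarrow> norm (f z) \<le> M"
  obtains h where "h holomorphic_on ball 0 1" "\<And>z. norm z < 1 \<Longrightarrow> f z = z * h z" "\<And>z. norm z < 1 \<Longrightarrow> norm (h z) \<le> M"
proof -
  obtain h where h: "h holomorphic_on ball 0 1" "\<And>z. norm z < 1 \<Longrightarrow> f z = z * h z" "deriv f 0 = h 0"
    using Schwarz3[OF holf f0] by metis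
  have M0: "0 \<le> M"
    using M[of 0] f0 by simp
  have "norm (h z) \<le> M" if z: "norm z < 1" for z
  proof (rule field_le_epsilon)
    fix e :: real assume e: "e > 0"
    \<comment> \<open>Division by \<open>M + e\<close> instead of \<open>M\<close> makes the values
      strictly less than 1 in modulus, as the Schwarz lemma requires, and admits
      \<open>M = 0\<close>.\<close>
    define F where "F z = f z / of_real (M + e)" for z
    have Me: "M + e > 0" using M0 e by simp
    have nMe: "cmod (of_real M + of_real e) = M + e"
      using Me by (metis norm_of_real of_real_add abs_of_pos)
    have holF: "F holomorphic_on ball 0 1"
      unfolding F_def using Me by (intro holomorphic_intros holf) (auto simp flip: of_real_add)
    have F0: "F 0 = 0" by (simp add: F_def f0)
    have F1: "norm (F w) < 1" if "norm w < 1" for w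
      using M[OF that] Me e by (simp add: F_def norm_divide nMe)
    note S = Schwarz_Lemma(1)[OF holF F0 F1] Schwarz_Lemma(2)[OF holF F0 F1]
    show "norm (h z) \<le> M + e"
    proof (cases "z = 0")
      case False
      have "norm (F z) \<le> norm z" by (rule S(1)) (use z in auto)
      then show ?thesis
        using False Me h(2)[OF z] by (simp add: F_def norm_divide norm_mult nMe pos_divide_le_eq)
    next
      case True
      have "f field_differentiable at 0"
        using holf by (rule holomorphic_on_imp_differentiable_at) auto
      then have "deriv F 0 = h 0 / of_real (M + e)"
        unfolding F_def h(3)[symmetric] by (rule deriv_cdivide_right)
      moreover have "norm (deriv F 0) \<le> 1"
        by (rule S(2)[of 0]) auto
      ultimately show ?thesis
        using True Me by (simp add: norm_divide nMe pos_divide_le_eq)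
    qed
  qed
  with h show ?thesis using that by blast
qed

text \<open>The disk automorphism \<open>Moebius_function 0 (- a)\<close> moves 0 to
  \<open>a\<close>, so precomposing with it reduces a zero at \<open>a\<close> to the case of
  \<open>Schwarz_factor\<close>.\<close>

lemma Blaschke_factor:
  assumes holf: "f holomorphic_on ball 0 1" and a: "norm a < 1" "f a = 0" and M: "\<And>z. norm z < 1 \<Longrightarrow> norm (f z) \<le> M"
  obtains g where "g holomorphic_on ball 0 1" "\<And>z. norm z < 1 \<Longrightarrow> norm (g z) \<le> M"
    "\<And>z. norm z < 1 \<Longrightarrow> f z = Moebius_function 0 a z * g z"
proof -
  let ?F = "f \<circ> Moebius_function 0 (- a)"
  have na: "norm (- a) < 1" using a by simp
  have im: "Moebius_function 0 b ` ball 0 1 \<subseteq> ball 0 1" if "norm b < 1" for b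
    using Moebius_function_norm_lt_1[OF that] by auto
  have "?F holomorphic_on ball 0 1"
    using holomorphic_on_compose_gen[OF Moebius_function_holomorphic[OF na] holf im[OF na]] .
  moreover have "?F 0 = 0"
    using a by (simp add: Moebius_function_of_zero)
  moreover have "norm (?F z) \<le> M" if "norm z < 1" for z
    using M Moebius_function_norm_lt_1[OF na that] by simp
  ultimately obtain h where h: "h holomorphic_on ball 0 1" "\<And>z. norm z < 1 \<Longrightarrow> ?F z = z * h z"
      "\<And>z. norm z < 1 \<Longrightarrow> norm (h z) \<le> M"
    using Schwarz_factor by metis
  show ?thesis
  proof
    show "(h \<circ> Moebius_function 0 a) holomorphic_on ball 0 1"
      using holomorphic_on_compose_gen[OF Moebius_function_holomorphic[OF a(1)] h(1) im[OF a(1)]] .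
    fix z :: complex assume z: "norm z < 1"
    show "norm ((h \<circ> Moebius_function 0 a) z) \<le> M"
      using h(3) Moebius_function_norm_lt_1[OF a(1) z] by simp
    show "f z = Moebius_function 0 a z * (h \<circ> Moebius_function 0 a) z"
      using h(2)[OF Moebius_function_norm_lt_1[OF a(1) z, of 0]] z a
        Moebius_function_compose[of "-a" a z] by simp
  qed
qed

text \<open>A finite form of Jensen's inequality. Zeros are split off one at a time: the factor for
  \<open>a\<close> has modulus \<open>norm a\<close> at 0 and vanishes only at \<open>a\<close>, so
  the other points stay zeros of the quotient and the bound \<open>M\<close> survives.\<close>

lemma norm_at_0_le_prod_zeros:
  assumes "finite Z" "f holomorphic_on ball 0 1" "\<And>z. norm z < 1 \<Longrightarrow> norm (f z) \<le> M"
    "\<And>z. z \<in> Z \<Longrightarrow> norm z < 1 \<and> f z = 0"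
  shows "norm (f 0) \<le> M * (\<Prod>z\<in>Z. norm z)"
  using assms
proof (induction Z arbitrary: f rule: finite_induct)
  case empty
  then show ?case by simp
next
  case (insert a Z)
  obtain g where g: "g holomorphic_on ball 0 1" "\<And>z. norm z < 1 \<Longrightarrow> norm (g z) \<le> M"
    "\<And>z. norm z < 1 \<Longrightarrow> f z = Moebius_function 0 a z * g z"
    using Blaschke_factor[of f a M] insert.prems by auto
  have "g z = 0" if "z \<in> Z" for z
  proof -
    have z: "norm z < 1" "f z = 0" "z \<noteq> a" using insert that by auto
    have a: "norm a < 1" using insert.prems by auto
    have "norm (cnj a * z) < 1"
      using mult_strict_mono[OF a z(1)] by (simp add: norm_mult)
    then have "1 - cnj a * z \<noteq> 0" by auto
    with z have "Moebius_function 0 a z \<noteq> 0" by (simp add: Moebius_function_simple)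
    then show ?thesis using g(3)[OF z(1)] z by simp
  qed
  then have "norm (g 0) \<le> M * (\<Prod>z\<in>Z. norm z)"
    using insert g by (intro insert.IH) auto
  then have "norm a * norm (g 0) \<le> norm a * (M * (\<Prod>z\<in>Z. norm z))"
    by (rule mult_left_mono) simp
  then show ?case
    using g(3)[of 0] insert.hyps by (simp add: norm_mult Moebius_function_of_zero mult_ac)
qed

section \<open>The system in polar coordinates\<close>

text \<open>One factor \<open>r\<close> has been divided out of every monomial;
  \<open>1 \<le> i + k\<close> on \<open>coeff_index d\<close> makes the exponent
  \<open>k + i - 1\<close> exact. The general field type lets the same formula serve the real
  trajectories and the complex Euler polygons.\<close>

definition polar_sum :: "nat \<Rightarrow> (nat \<times> nat \<Rightarrow> real) \<Rightarrow> real \<Rightarrow> 'a \<Rightarrow> 'a :: real_normed_field" where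
  "polar_sum d c \<phi> r = (\<Sum>(k, i)\<in>coeff_index d. of_real (c (k, i) * (cos \<phi> ^ k * sin \<phi> ^ i)) * r ^ (k + i - 1))"

definition radial :: "nat \<Rightarrow> coeffs \<Rightarrow> real \<Rightarrow> 'a \<Rightarrow> 'a :: real_normed_field" where
  "radial d v \<phi> = polar_sum d (\<lambda>m. Poly_Mapping.lookup (fst v) m * cos \<phi> + Poly_Mapping.lookup (snd v) m * sin \<phi>) \<phi>"

definition angular :: "nat \<Rightarrow> coeffs \<Rightarrow> real \<Rightarrow> 'a \<Rightarrow> 'a :: real_normed_field" where
  "angular d v \<phi> = polar_sum d (\<lambda>m. Poly_Mapping.lookup (snd v) m * cos \<phi> - Poly_Mapping.lookup (fst v) m * sin \<phi>) \<phi>"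

text \<open>
  In polar coordinates \<open>r' = r * radial\<close> and \<open>\<phi>' = 1 + angular\<close>, so that \<open>slope\<close> is the derivative
  of \<open>ln r\<close> with respect to \<open>\<phi>\<close>.
\<close>

definition slope :: "nat \<Rightarrow> coeffs \<Rightarrow> real \<Rightarrow> 'a \<Rightarrow> 'a :: real_normed_field" where
  "slope d v \<phi> r = radial d v \<phi> r / (1 + angular d v \<phi> r)"

text \<open>The terms of each total degree are dominated by a binomial expansion of
  \<open>(x + y)\<close> to that degree, which equals 1. With the squares of cosine and sine for
  \<open>x\<close> and \<open>y\<close>, this gives \<open>sqrt d\<close> in
  \<open>norm_polar_sum_le\<close>, instead of the square root of the number of monomials.\<close>

lemma sum_coeff_index_le:
  assumes "x \<ge> 0" "y \<ge> 0" "x + y = (1 :: real)"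
  shows "(\<Sum>(k, i)\<in>coeff_index d. x ^ k * y ^ i) \<le> real d"
proof (induction d)
  case 0
  have "coeff_index 0 = {}"
    by (auto simp: coeff_index_def)
  then show ?case by simp
next
  case (Suc d)
  let ?A = "(\<lambda>k. (k, Suc d - k)) ` {..Suc d}"
  have eq: "coeff_index (Suc d) = coeff_index d \<union> ?A"
    by (auto simp: coeff_index_def image_iff)
  have disj: "coeff_index d \<inter> ?A = {}"
    by (auto simp: coeff_index_def)
  have "(\<Sum>(k, i)\<in>?A. x ^ k * y ^ i) = (\<Sum>k\<le>Suc d. 1 * x ^ k * y ^ (Suc d - k))"
    by (subst sum.reindex) (auto simp: inj_on_def)
  also have "\<dots> \<le> (\<Sum>k\<le>Suc d. of_nat (Suc d choose k) * x ^ k * y ^ (Suc d - k))"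
  proof (intro sum_mono mult_right_mono)
    fix k assume "k \<in> {..Suc d}"
    then have "1 \<le> Suc d choose k"
      by (simp add: Suc_le_eq zero_less_binomial_iff del: binomial_Suc_Suc)
    then show "1 \<le> (of_nat (Suc d choose k) :: real)"
      by (metis of_nat_1 of_nat_le_iff)
  qed (use assms in auto)
  also have "\<dots> = (x + y) ^ Suc d"
    by (rule binomial_ring[symmetric])
  finally have "(\<Sum>(k, i)\<in>?A. x ^ k * y ^ i) \<le> 1"
    using assms by simp
  then show ?case
    using Suc finite_coeff_index[of d] unfolding eq by (subst sum.union_disjoint[OF _ _ disj]) auto
qed

lemma polar_sum_of_real: "polar_sum d c \<phi> (of_real r) = of_real (polar_sum d c \<phi> r)"
  by (simp add: polar_sum_def case_prod_unfold)

lemma norm_polar_sum_le: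
  fixes r :: "'a :: real_normed_field"
  assumes "norm r \<le> 1"
  shows "norm (polar_sum d c \<phi> r) \<le> L2_set c (coeff_index d) * sqrt (real d)"
proof -
  let ?t = "\<lambda>(k, i). cos \<phi> ^ k * sin \<phi> ^ i"
  have "norm (polar_sum d c \<phi> r) \<le> (\<Sum>m\<in>coeff_index d. \<bar>c m\<bar> * \<bar>?t m\<bar>)"
    unfolding polar_sum_def
  proof (rule sum_norm_le)
    fix m assume "m \<in> coeff_index d"
    obtain k i where m: "m = (k, i)" by (cases m)
    have "norm (r ^ (k + i - 1)) \<le> 1"
      unfolding norm_power using assms by (intro power_le_one) auto
    then have "\<bar>c m * ?t m\<bar> * norm (r ^ (k + i - 1)) \<le> \<bar>c m * ?t m\<bar> * 1"
      by (intro mult_left_mono) auto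
    then show "norm (case m of (k, i) \<Rightarrow> of_real (c (k, i) * (cos \<phi> ^ k * sin \<phi> ^ i)) * r ^ (k + i - 1))
       \<le> \<bar>c m\<bar> * \<bar>?t m\<bar>"
      by (simp add: m norm_mult abs_mult del: of_real_mult)
  qed
  also have "\<dots> \<le> L2_set c (coeff_index d) * L2_set ?t (coeff_index d)"
    by (rule L2_set_mult_ineq)
  also have "L2_set ?t (coeff_index d) \<le> sqrt (real d)"
  proof -
    have "(\<Sum>m\<in>coeff_index d. (?t m)\<^sup>2) = (\<Sum>(k, i)\<in>coeff_index d. ((cos \<phi>)\<^sup>2) ^ k * ((sin \<phi>)\<^sup>2) ^ i)"
      by (intro sum.cong) (auto simp: power_mult_distrib power2_eq_square)
    also have "\<dots> \<le> real d"
      by (rule sum_coeff_index_le) auto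
    finally show ?thesis
      by (simp add: L2_set_def)
  qed
  then have "L2_set c (coeff_index d) * L2_set ?t (coeff_index d) \<le> L2_set c (coeff_index d) * sqrt (real d)"
    by (intro mult_left_mono) auto
  finally show ?thesis .
qed

text \<open>The constant may be crude: Lipschitz bounds serve only convergence and uniqueness and
  never reach the final estimate.\<close>

lemma polar_sum_lipschitz:
  fixes r s :: "'a :: real_normed_field"
  assumes "norm r \<le> 1" "norm s \<le> 1" "\<And>m. \<bar>c m\<bar> \<le> C"
  shows "norm (polar_sum d c \<phi> r - polar_sum d c \<phi> s) \<le> C * d * card (coeff_index d) * norm (r - s)"
proof -
  have "norm (polar_sum d c \<phi> r - polar_sum d c \<phi> s) \<le> of_nat (card (coeff_index d)) * (C * (d * norm (r - s)))"
    unfolding polar_sum_def sum_subtractf[symmetric]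
  proof (rule sum_norm_bound)
    fix m assume m: "m \<in> coeff_index d"
    obtain k i where ki: "m = (k, i)" by (cases m)
    have "\<bar>cos \<phi> ^ k * sin \<phi> ^ i\<bar> \<le> 1 * 1"
      unfolding abs_mult power_abs by (intro mult_mono power_le_one) auto
    then have "\<bar>c m\<bar> * \<bar>cos \<phi> ^ k * sin \<phi> ^ i\<bar> \<le> \<bar>c m\<bar> * 1"
      by (intro mult_left_mono) auto
    then have 1: "\<bar>c m\<bar> * \<bar>cos \<phi> ^ k * sin \<phi> ^ i\<bar> \<le> C"
      using assms(3)[of m] by simp
    have "norm (r ^ (k + i - 1) - s ^ (k + i - 1)) \<le> real (k + i - 1) * norm (r - s)"
      by (rule norm_power_diff) (use assms in auto)
    also have "\<dots> \<le> d * norm (r - s)"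
      using m ki by (intro mult_right_mono) (auto simp: coeff_index_def)
    finally have 2: "norm (r ^ (k + i - 1) - s ^ (k + i - 1)) \<le> d * norm (r - s)" .
    have "norm (of_real (c m * (cos \<phi> ^ k * sin \<phi> ^ i)) * (r ^ (k + i - 1) - s ^ (k + i - 1)))
       = (\<bar>c m\<bar> * \<bar>cos \<phi> ^ k * sin \<phi> ^ i\<bar>) * norm (r ^ (k + i - 1) - s ^ (k + i - 1))"
      by (simp only: norm_mult norm_of_real abs_mult)
    also have "\<dots> \<le> C * (d * norm (r - s))"
      using assms(3)[of m] by (intro mult_mono[OF 1 2]) auto
    finally show "norm ((case m of (k, i) \<Rightarrow> of_real (c (k, i) * (cos \<phi> ^ k * sin \<phi> ^ i)) * r ^ (k + i - 1)) -
        (case m of (k, i) \<Rightarrow> of_real (c (k, i) * (cos \<phi> ^ k * sin \<phi> ^ i)) * s ^ (k + i - 1)))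
        \<le> C * (d * norm (r - s))"
      by (simp add: ki right_diff_distrib)
  qed
  then show ?thesis by (simp add: mult_ac)
qed

text \<open>The Euler scheme for the unknown \<open>w = ln (r / \<rho>)\<close>, whose equation is
  \<open>w' = slope d v \<phi> (\<rho> * exp w)\<close> with \<open>w = 0\<close> at the start. The
  angle stays real while the radius \<open>\<rho>\<close> is complex and may be 0.\<close>

primrec euler :: "nat \<Rightarrow> coeffs \<Rightarrow> real \<Rightarrow> complex \<Rightarrow> nat \<Rightarrow> complex" where
  "euler d v h \<rho> 0 = 0"
| "euler d v h \<rho> (Suc k) = euler d v h \<rho> k + of_real h * slope d v (real k * h) (\<rho> * exp (euler d v h \<rho> k))"

section \<open>Bounds on the polar equation for small coefficients\<close>

locale small_field =
  fixes d :: nat and v :: coeffs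
  assumes v: "v \<in> coeff_space d" and d: "1 \<le> d" and small: "sqrt (real d) * coeff_norm v \<le> 1 / (40 * pi)"
begin

abbreviation \<kappa> :: real where "\<kappa> \<equiv> sqrt (real d) * coeff_norm v"

lemma kappa_nonneg: "0 \<le> \<kappa>"
  by (simp add: coeff_norm_def coeff_inner_self_nonneg)

lemma kappa_le: "\<kappa> \<le> 1 / 80"
proof -
  have "1 / (40 * pi) \<le> 1 / (40 * 2)"
    using pi_ge_two by (intro divide_left_mono mult_left_mono) auto
  from order_trans[OF small this] show ?thesis by simp
qed

text \<open>For each monomial the radial and angular coefficients arise from its pair of
  coefficients by a rotation, so neither family exceeds \<open>coeff_norm v\<close> in Euclidean
  norm; \<open>norm_polar_sum_le\<close> supplies the factor \<open>sqrt d\<close>.\<close>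

lemma norm_radial_le: "norm (r :: 'a :: real_normed_field) \<le> 1 \<Longrightarrow> norm (radial d v \<phi> r) \<le> \<kappa>"
  and norm_angular_le: "norm r \<le> 1 \<Longrightarrow> norm (angular d v \<phi> r) \<le> \<kappa>"
proof -
  let ?a = "Poly_Mapping.lookup (fst v)" and ?b = "Poly_Mapping.lookup (snd v)"
  have sq: "(a * c + b * s)\<^sup>2 \<le> a * a + b * b" "(b * c - a * s)\<^sup>2 \<le> a * a + b * b"
    if "c\<^sup>2 + s\<^sup>2 = (1::real)" for a b c s
  proof -
    have "(a * c + b * s)\<^sup>2 + (b * c - a * s)\<^sup>2 = (a * a + b * b) * (c\<^sup>2 + s\<^sup>2)"
      by (simp add: power2_eq_square algebra_simps)
    then have "(a * c + b * s)\<^sup>2 + (b * c - a * s)\<^sup>2 = a * a + b * b"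
      using that by simp
    then show "(a * c + b * s)\<^sup>2 \<le> a * a + b * b" "(b * c - a * s)\<^sup>2 \<le> a * a + b * b"
      by (smt (verit) zero_le_power2)+
  qed
  have "L2_set (\<lambda>m. ?a m * cos \<phi> + ?b m * sin \<phi>) (coeff_index d) \<le> coeff_norm v"
       "L2_set (\<lambda>m. ?b m * cos \<phi> - ?a m * sin \<phi>) (coeff_index d) \<le> coeff_norm v"
    unfolding L2_set_def coeff_norm_def coeff_inner_coeff_space[OF v]
    by (intro real_sqrt_le_mono sum_mono sq; simp)+
  from this[THEN mult_right_mono, of "sqrt (real d)"]
  have "L2_set (\<lambda>m. ?a m * cos \<phi> + ?b m * sin \<phi>) (coeff_index d) * sqrt (real d) \<le> \<kappa>"
       "L2_set (\<lambda>m. ?b m * cos \<phi> - ?a m * sin \<phi>) (coeff_index d) * sqrt (real d) \<le> \<kappa>"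
    by (simp_all only: mult.commute[of "sqrt (real d)"] real_sqrt_ge_zero of_nat_0_le_iff)
  then show "norm r \<le> 1 \<Longrightarrow> norm (radial d v \<phi> r) \<le> \<kappa>" "norm r \<le> 1 \<Longrightarrow> norm (angular d v \<phi> r) \<le> \<kappa>"
    unfolding radial_def angular_def by (blast intro: order_trans[OF norm_polar_sum_le])+
qed

lemma norm_denominator_ge:
  fixes r :: "'a :: real_normed_field"
  assumes "norm r \<le> 1" shows "9/10 \<le> norm (1 + angular d v \<phi> r)"
proof -
  have "norm (1 :: 'a) - norm (angular d v \<phi> r) \<le> norm (1 + angular d v \<phi> r)"
    by (metis add_uminus_conv_diff norm_minus_cancel norm_triangle_ineq2 diff_minus_eq_add)
  then show ?thesis
    using norm_angular_le[OF assms, of \<phi>] kappa_le by simp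
qed

lemma denominator_nonzero: "norm (r :: 'a :: real_normed_field) \<le> 1 \<Longrightarrow> 1 + angular d v \<phi> r \<noteq> 0"
  using norm_denominator_ge[of r \<phi>] by auto

lemma norm_slope_le:
  fixes r :: "'a :: real_normed_field"
  assumes "norm r \<le> 1" shows "norm (slope d v \<phi> r) \<le> 10 / 9 * \<kappa>"
proof -
  have "norm (slope d v \<phi> r) \<le> \<kappa> / (9/10)"
    unfolding slope_def norm_divide
    by (intro frac_le norm_radial_le norm_denominator_ge assms kappa_nonneg) auto
  then show ?thesis by simp
qed

lemma slope_lipschitz:
  "\<exists>L\<ge>0. \<forall>\<phi> r s. norm (r :: 'a :: real_normed_field) \<le> 1 \<longrightarrow> norm s \<le> 1 \<longrightarrow>
     norm (slope d v \<phi> r - slope d v \<phi> s) \<le> L * norm (r - s)"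
proof -
  define C where "C = 2 * coeff_norm v"
  define K where "K = C * d * card (coeff_index d)"
  have C0: "C \<ge> 0" by (simp add: C_def coeff_norm_def coeff_inner_self_nonneg)
  then have K0: "K \<ge> 0" by (simp add: K_def)
  have bound: "\<bar>x * c + y * s\<bar> \<le> C" "\<bar>x * c - y * s\<bar> \<le> C"
    if "\<bar>x\<bar> \<le> coeff_norm v" "\<bar>y\<bar> \<le> coeff_norm v" "\<bar>c\<bar> \<le> 1" "\<bar>s\<bar> \<le> 1" for x y c s
  proof -
    have "\<bar>x * c\<bar> \<le> \<bar>x\<bar>" "\<bar>y * s\<bar> \<le> \<bar>y\<bar>"
      using that by (simp_all add: abs_mult mult_left_le)
    then show "\<bar>x * c + y * s\<bar> \<le> C" "\<bar>x * c - y * s\<bar> \<le> C"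
      using that unfolding C_def by linarith+
  qed
  have A: "norm (radial d v \<phi> r - radial d v \<phi> s) \<le> K * norm (r - s)"
    if "norm r \<le> 1" "norm s \<le> 1" for \<phi> and r s :: 'a
    unfolding radial_def K_def
    by (intro polar_sum_lipschitz that bound(1) abs_lookup_le_coeff_norm) auto
  have B: "norm (angular d v \<phi> r - angular d v \<phi> s) \<le> K * norm (r - s)"
    if "norm r \<le> 1" "norm s \<le> 1" for \<phi> and r s :: 'a
    unfolding angular_def K_def
    by (intro polar_sum_lipschitz that bound(2) abs_lookup_le_coeff_norm) auto
  have "norm (slope d v \<phi> r - slope d v \<phi> s) \<le> 4 * K * norm (r - s)"
    if rs: "norm r \<le> 1" "norm s \<le> 1" for \<phi> and r s :: 'a
  proof -
    let ?A = "radial d v \<phi>" and ?B = "angular d v \<phi>"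
    have nz: "1 + ?B r \<noteq> 0" "1 + ?B s \<noteq> 0"
      using denominator_nonzero rs by auto
    \<comment> \<open>Inserting the quotient at \<open>s\<close> leaves only the denominator at
      \<open>r\<close>, and the factor \<open>slope d v \<phi> s\<close> is at most 1 in
      norm.\<close>
    have "slope d v \<phi> r - slope d v \<phi> s = (?A r - ?A s) / (1 + ?B r) + slope d v \<phi> s * (?B s - ?B r) / (1 + ?B r)"
    proof -
      have "slope d v \<phi> s * (1 + ?B s) = ?A s"
        using nz by (simp add: slope_def)
      then have "slope d v \<phi> s * (?B s - ?B r) = ?A s - slope d v \<phi> s * (1 + ?B r)"
        by (simp add: algebra_simps)
      then show ?thesis
        using nz(1) by (simp add: slope_def[of d v \<phi> r] diff_divide_distrib)
    qed
    also have "norm \<dots> \<le> norm (?A r - ?A s) / norm (1 + ?B r) + norm (slope d v \<phi> s) * norm (?B r - ?B s) / norm (1 + ?B r)"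
      by (intro order_trans[OF norm_triangle_ineq]) (simp add: norm_divide norm_mult norm_minus_commute)
    also have "\<dots> \<le> K * norm (r - s) / (9/10) + 1 * (K * norm (r - s)) / (9/10)"
    proof -
      have "norm (slope d v \<phi> s) \<le> 1"
        using norm_slope_le[OF rs(2), of \<phi>] kappa_le by simp
      then show ?thesis
        using K0 by (intro add_mono frac_le mult_mono A B rs norm_denominator_ge) auto
    qed
    also have "\<dots> \<le> 4 * K * norm (r - s)"
      using mult_nonneg_nonneg[OF K0 norm_ge_zero[of "r - s"]] by simp
    finally show ?thesis .
  qed
  with K0 show ?thesis
    by (intro exI[of _ "4 * K"]) auto
qed

lemma slope_of_real: "slope d v \<phi> (of_real r) = of_real (slope d v \<phi> r)"
  by (simp add: slope_def radial_def angular_def polar_sum_of_real)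

lemma slope_holomorphic: "slope d v \<phi> holomorphic_on ball 0 1"
proof -
  have "polar_sum d c \<phi> holomorphic_on ball 0 1" for c
    unfolding polar_sum_def case_prod_unfold by (intro holomorphic_intros)
  then show ?thesis
    unfolding slope_def radial_def angular_def
    by (intro holomorphic_intros) (use denominator_nonzero in \<open>force simp: angular_def\<close>)+
qed

lemma continuous_on_polar:
  fixes f :: "real \<Rightarrow> real"
  assumes "continuous_on S f"
  shows "continuous_on S (\<lambda>\<phi>. radial d v \<phi> (f \<phi>))" "continuous_on S (\<lambda>\<phi>. angular d v \<phi> (f \<phi>))"
  unfolding radial_def angular_def polar_sum_def case_prod_unfold
  by (intro continuous_intros assms)+

lemma continuous_on_slope:
  fixes f :: "real \<Rightarrow> real"
  assumes "continuous_on S f" "\<And>\<phi>. \<phi> \<in> S \<Longrightarrow> \<bar>f \<phi>\<bar> \<le> 1"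
  shows "continuous_on S (\<lambda>\<phi>. slope d v \<phi> (f \<phi>))"
proof -
  have "1 + angular d v \<phi> (f \<phi>) \<noteq> 0" if "\<phi> \<in> S" for \<phi>
    using denominator_nonzero[of "f \<phi>" \<phi>] assms(2)[OF that] by simp
  then show ?thesis
    unfolding slope_def by (intro continuous_intros continuous_on_polar assms) auto
qed

section \<open>Euler polygons\<close>

text \<open>The three bounds must go through the induction together: the next slope is controlled
  only while the polygon stays in the unit disk. A full turn adds at most
  \<open>2 * pi * (10 / 9) / (40 * pi) = 1 / 18\<close> to the logarithm, and
  \<open>exp (1 / 18) \<le> 18 / 17\<close> keeps radii below \<open>9 / 10\<close> inside the unit
  disk, since \<open>9 / 10 * (18 / 17) < 1\<close>.\<close>

lemma norm_euler_le:
  assumes "0 \<le> h" "norm \<rho> < 9/10"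
  shows "real k * h \<le> 2 * pi \<Longrightarrow>
    norm (euler d v h \<rho> k) \<le> real k * h * (10 / 9 * \<kappa>) \<and> norm (euler d v h \<rho> k) \<le> 1 / 18 \<and> norm (\<rho> * exp (euler d v h \<rho> k)) < 1"
proof (induction k)
  case 0
  show ?case using assms by simp
next
  case (Suc k)
  have kh: "real k * h \<le> 2 * pi"
    using Suc.prems assms(1) by (simp add: algebra_simps)
  note IH = Suc.IH[OF kh]
  let ?e = "euler d v h \<rho> (Suc k)"
  have "norm ?e \<le> norm (euler d v h \<rho> k) + h * norm (slope d v (real k * h) (\<rho> * exp (euler d v h \<rho> k)))"
    using assms(1) by (auto intro!: order_trans[OF norm_triangle_ineq] simp: norm_mult)
  also have "\<dots> \<le> real k * h * (10 / 9 * \<kappa>) + h * (10 / 9 * \<kappa>)"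
    using IH assms(1) by (intro add_mono mult_left_mono norm_slope_le) auto
  also have "\<dots> = real (Suc k) * h * (10 / 9 * \<kappa>)"
    by (simp add: algebra_simps)
  finally have 1: "norm ?e \<le> real (Suc k) * h * (10 / 9 * \<kappa>)" .
  also have "\<dots> \<le> (2 * pi) * (10 / 9 * (1 / (40 * pi)))"
    using kappa_nonneg by (intro mult_mono[OF Suc.prems] mult_left_mono[OF small]) auto
  finally have 2: "norm ?e \<le> 1 / 18"
    by simp
  have "1 + (- (1 / 18)) \<le> exp (- (1 / 18 :: real))"
    by (rule exp_ge_add_one_self)
  then have e18: "exp (1 / 18 :: real) \<le> 18 / 17"
    by (simp add: exp_minus field_simps)
  have "norm (exp ?e) \<le> exp (norm ?e)" by (rule norm_exp)
  also have "\<dots> \<le> exp (1 / 18)" using 2 by simp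
  finally have "norm (exp ?e) \<le> 18 / 17"
    using e18 by linarith
  then have "norm (\<rho> * exp ?e) \<le> 9/10 * (18 / 17)"
    unfolding norm_mult using assms(2) by (intro mult_mono) auto
  with 1 2 show ?case by simp
qed

lemma euler_holomorphic:
  assumes "0 \<le> h"
  shows "real k * h \<le> 2 * pi \<Longrightarrow> (\<lambda>\<rho>. euler d v h \<rho> k) holomorphic_on ball 0 (9/10)"
proof (induction k)
  case 0
  show ?case by simp
next
  case (Suc k)
  have kh: "real k * h \<le> 2 * pi"
    using Suc.prems assms(1) by (simp add: algebra_simps)
  note IH = Suc.IH[OF kh]
  have "(\<lambda>\<rho>. \<rho> * exp (euler d v h \<rho> k)) ` ball 0 (9/10) \<subseteq> ball 0 1"
    using norm_euler_le[OF assms _ kh] by auto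
  moreover have "(\<lambda>\<rho>. \<rho> * exp (euler d v h \<rho> k)) holomorphic_on ball 0 (9/10)"
    by (intro holomorphic_intros IH)
  ultimately have "(slope d v (real k * h) \<circ> (\<lambda>\<rho>. \<rho> * exp (euler d v h \<rho> k))) holomorphic_on ball 0 (9/10)"
    by (intro holomorphic_on_compose_gen[OF _ slope_holomorphic])
  then show ?case
    by (auto intro!: holomorphic_intros IH simp: o_def)
qed

lemma exp_lipschitz:
  fixes z w :: complex
  assumes "norm z \<le> B" "norm w \<le> B"
  shows "norm (exp z - exp w) \<le> exp B * norm (z - w)"
proof (rule field_differentiable_bound)
  show "convex (cball 0 B :: complex set)" by (rule convex_cball)
  show "(exp has_field_derivative exp x) (at x within cball 0 B)" for x :: complex
    by (rule DERIV_exp[THEN DERIV_subset]) auto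
  show "norm (exp x) \<le> exp B" if "x \<in> cball 0 B" for x :: complex
    using norm_exp[of x] that by (auto intro: order_trans)
qed (use assms in auto)

text \<open>Comparison with a given real solution \<open>W\<close>. Only uniform continuity of its
  derivative is used for the local error, not a second derivative.\<close>

lemma euler_converges:
  fixes W :: "real \<Rightarrow> real" and \<rho> :: real
  assumes \<rho>: "0 \<le> \<rho>" "\<rho> < 9/10" and W0: "W 0 = 0"
    and W: "\<And>\<phi>. (W has_real_derivative slope d v \<phi> (\<rho> * exp (W \<phi>))) (at \<phi>)"
    and W1: "\<And>\<phi>. \<rho> * exp (W \<phi>) \<le> 1"
  shows "(\<lambda>n. euler d v (2 * pi / Suc n) (of_real \<rho>) (Suc n)) \<longlonglongrightarrow> of_real (W (2 * pi))"
proof (rule LIMSEQ_I)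
  fix \<epsilon> :: real assume eps: "\<epsilon> > 0"
  define \<Phi> where "\<Phi> \<phi> = slope d v \<phi> (\<rho> * exp (W \<phi>))" for \<phi>
  have contW: "continuous_on S W" for S
    using W by (meson DERIV_isCont continuous_at_imp_continuous_on)
  have cont\<Phi>: "continuous_on S \<Phi>" for S
    unfolding \<Phi>_def using \<rho> W1 by (intro continuous_on_slope continuous_intros contW) auto
  have "bounded (W ` {0..2*pi})"
    by (intro compact_imp_bounded compact_continuous_image contW compact_Icc)
  then obtain B0 where B0: "\<forall>x\<in>W ` {0..2*pi}. norm x \<le> B0"
    unfolding bounded_iff by blast
  \<comment> \<open>The 1 lets \<open>B\<close> bound the Euler values as well, which are at most
    \<open>1 / 18\<close>.\<close>
  define B where "B = max B0 1"
  have B: "\<bar>W \<phi>\<bar> \<le> B" if "0 \<le> \<phi>" "\<phi> \<le> 2 * pi" for \<phi>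
  proof -
    have "W \<phi> \<in> W ` {0..2*pi}" using that by auto
    then show ?thesis using B0 by (force simp: B_def)
  qed
  obtain L where L: "L \<ge> 0" "\<And>\<phi> (r :: complex) s. norm r \<le> 1 \<Longrightarrow> norm s \<le> 1 \<Longrightarrow>
     norm (slope d v \<phi> r - slope d v \<phi> s) \<le> L * norm (r - s)"
    using slope_lipschitz[where 'a=complex] by blast
  define L' where "L' = L * exp B"
  have L': "L' \<ge> 0" using L by (simp add: L'_def)
  \<comment> \<open>Chosen so that the accumulated error
    \<open>2 * pi * \<eta> * exp (2 * pi * L')\<close> after a full turn is
    \<open>\<epsilon> / 2\<close>.\<close>
  define \<eta> where "\<eta> = \<epsilon> / (4 * pi * exp (2 * pi * L'))"
  have \<eta>: "\<eta> > 0" using eps by (simp add: \<eta>_def)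
  have "uniformly_continuous_on {0..2*pi} \<Phi>"
    by (intro compact_uniformly_continuous cont\<Phi>) auto
  then obtain \<delta> where \<delta>: "\<delta> > 0" "\<And>x y. x \<in> {0..2*pi} \<Longrightarrow> y \<in> {0..2*pi} \<Longrightarrow> dist x y < \<delta> \<Longrightarrow> dist (\<Phi> x) (\<Phi> y) < \<eta>"
    unfolding uniformly_continuous_on_def using \<eta> by metis
  obtain n0 :: nat where n0: "2 * pi / \<delta> < real n0"
    using reals_Archimedean2 by blast
  have "norm (euler d v (2 * pi / Suc n) (of_real \<rho>) (Suc n) - of_real (W (2 * pi))) < \<epsilon>" if n: "n \<ge> n0" for n
  proof -
    define h where "h = 2 * pi / Suc n"
    have h: "h > 0" by (simp add: h_def)
    have "2 * pi / \<delta> < real (Suc n)" using n0 n by linarith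
    then have h\<delta>: "h < \<delta>" using \<delta>(1) by (simp add: h_def field_simps)
    let ?e = "euler d v h (of_real \<rho>)"
    have n\<rho>: "norm (of_real \<rho> :: complex) < 9/10" using \<rho> by simp
    \<comment> \<open>A discrete Gronwall bound: each step multiplies the old error by at most
      \<open>1 + h * L'\<close> and adds at most \<open>h * \<eta>\<close>.\<close>
    have E: "k \<le> Suc n \<Longrightarrow> norm (?e k - of_real (W (k * h))) \<le> k * h * \<eta> * exp (L' * (k * h))" for k
    proof (induction k)
      case 0
      show ?case by (simp add: W0)
    next
      case (Suc k)
      have Sk: "real (Suc k) * h \<le> 2 * pi"
      proof -
        have "real (Suc k) * h \<le> real (Suc n) * h"
          using Suc.prems h by (intro mult_right_mono) (auto simp del: of_nat_Suc)
        then show ?thesis by (simp add: h_def del: of_nat_Suc)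
      qed
      have kh: "real k * h \<le> 2 * pi" "0 \<le> real k * h"
        using Sk h by (auto simp: algebra_simps)
      let ?t = "real k * h"
      have Sk': "real (Suc k) * h = ?t + h" by (simp add: algebra_simps)
      note eu = norm_euler_le[OF less_imp_le[OF h] n\<rho> kh(1)]
      have "\<exists>z>?t. z < ?t + h \<and> W (?t + h) - W ?t = (?t + h - ?t) * \<Phi> z"
        unfolding \<Phi>_def using h W by (intro MVT2) auto
      then obtain z where z: "?t < z" "z < ?t + h" "W (?t + h) - W ?t = h * \<Phi> z"
        by auto
      have "dist (\<Phi> z) (\<Phi> ?t) < \<eta>"
      proof (rule \<delta>(2))
        show "z \<in> {0..2 * pi}" "?t \<in> {0..2 * pi}"
          using z kh Sk unfolding Sk' atLeastAtMost_iff by linarith+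
        show "dist z ?t < \<delta>"
          using z h\<delta> unfolding dist_real_def by linarith
      qed
      then have loc: "\<bar>W (?t + h) - W ?t - h * \<Phi> ?t\<bar> \<le> h * \<eta>"
        using h unfolding z(3) by (simp add: dist_real_def abs_mult flip: right_diff_distrib)
      define S1 where "S1 = slope d v ?t (of_real \<rho> * exp (?e k))"
      have "norm (S1 - of_real (\<Phi> ?t)) \<le> L * norm (of_real \<rho> * exp (?e k) - of_real \<rho> * exp (of_real (W ?t)))"
      proof -
        have r: "of_real (\<Phi> ?t) = slope d v ?t (of_real \<rho> * exp (of_real (W ?t)) :: complex)"
          unfolding \<Phi>_def by (simp flip: slope_of_real exp_of_real)
        have "norm (of_real \<rho> * exp (of_real (W ?t)) :: complex) \<le> 1"
          using W1[of ?t] \<rho> by (simp add: norm_mult)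
        then show ?thesis
          unfolding S1_def r using eu by (intro L(2)) auto
      qed
      also have "\<dots> = L * (\<rho> * norm (exp (?e k) - exp (of_real (W ?t))))"
        using \<rho> by (simp add: norm_mult flip: right_diff_distrib)
      also have "\<dots> \<le> L * (1 * (exp B * norm (?e k - of_real (W ?t))))"
        using \<rho> eu B[OF kh(2,1)] L(1) by (intro mult_left_mono mult_mono exp_lipschitz) (auto simp: B_def)
      also have "\<dots> = L' * norm (?e k - of_real (W ?t))" by (simp add: L'_def)
      finally have S1: "norm (S1 - of_real (\<Phi> ?t)) \<le> L' * norm (?e k - of_real (W ?t))" .
      define c where "c = norm (?e k - of_real (W ?t))"
      have c: "c \<le> ?t * \<eta> * exp (L' * ?t)"
        unfolding c_def using Suc by simp
      have "?e (Suc k) - of_real (W (?t + h)) =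
         (?e k - of_real (W ?t)) + of_real h * (S1 - of_real (\<Phi> ?t)) - of_real (W (?t + h) - W ?t - h * \<Phi> ?t)"
        by (simp add: S1_def algebra_simps)
      also have "norm \<dots> \<le> c + h * (L' * c) + h * \<eta>"
      proof -
        have "norm (of_real h * (S1 - of_real (\<Phi> ?t))) \<le> h * (L' * c)"
          unfolding norm_mult c_def using S1 h by (auto intro: mult_left_mono)
        moreover have "norm (of_real (W (?t + h) - W ?t - h * \<Phi> ?t) :: complex) \<le> h * \<eta>"
          using loc by (simp only: norm_of_real)
        ultimately show ?thesis
          using norm_triangle_ineq4[of "?e k - of_real (W ?t) + of_real h * (S1 - of_real (\<Phi> ?t))"
              "of_real (W (?t + h) - W ?t - h * \<Phi> ?t)"]
            norm_triangle_ineq[of "?e k - of_real (W ?t)" "of_real h * (S1 - of_real (\<Phi> ?t))"]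
          unfolding c_def by linarith
      qed
      also have "\<dots> = (1 + h * L') * c + h * \<eta>" by (simp add: algebra_simps)
      also have "\<dots> \<le> exp (h * L') * (?t * \<eta> * exp (L' * ?t)) + h * \<eta> * exp (L' * (?t + h))"
      proof (rule add_mono)
        show "(1 + h * L') * c \<le> exp (h * L') * (?t * \<eta> * exp (L' * ?t))"
          by (intro mult_mono c exp_ge_add_one_self) (auto simp: c_def)
        have "1 \<le> exp (L' * (?t + h))" using L' kh h by simp
        from mult_left_mono[OF this, of "h * \<eta>"] show "h * \<eta> \<le> h * \<eta> * exp (L' * (?t + h))"
          using h \<eta> by simp
      qed
      also have "\<dots> = (?t + h) * \<eta> * exp (L' * (?t + h))"
        by (simp add: distrib_left distrib_right exp_add mult_ac)
      finally show ?case unfolding Sk' .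
    qed
    have Sn: "real (Suc n) * h = 2 * pi" by (simp add: h_def del: of_nat_Suc)
    have "norm (?e (Suc n) - of_real (W (2 * pi))) \<le> 2 * pi * \<eta> * exp (L' * (2 * pi))"
      using E[of "Suc n"] unfolding Sn by simp
    also have "\<dots> = \<epsilon> / 2"
      by (simp add: \<eta>_def mult_ac)
    also have "\<dots> < \<epsilon>" using eps by simp
    finally show ?thesis by (simp add: h_def)
  qed
  then show "\<exists>no. \<forall>n\<ge>no. norm (euler d v (2 * pi / Suc n) (of_real \<rho>) (Suc n) - of_real (W (2 * pi))) < \<epsilon>"
    by blast
qed

section \<open>The trace bounds the number of zeros\<close>

lemma polar_sum_0:
  "polar_sum d c \<phi> (0 :: real) = c (1, 0) * cos \<phi> + c (0, 1) * sin \<phi>"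
proof -
  have "polar_sum d c \<phi> (0 :: real) = (\<Sum>(k, i)\<in>{(1, 0), (0, 1)}. of_real (c (k, i) * (cos \<phi> ^ k * sin \<phi> ^ i)) * 0 ^ (k + i - 1))"
    unfolding polar_sum_def
    by (rule sum.mono_neutral_right) (use d finite_coeff_index in \<open>auto simp: coeff_index_def zero_power\<close>)
  then show ?thesis by simp
qed

text \<open>
  At the origin \<open>radial = trace / 2 - angular' / 2\<close>, and \<open>ln (1 + angular)\<close> is periodic.
\<close>

lemma trace_le_linear_return:
  fixes W :: "real \<Rightarrow> real"
  assumes W: "\<And>\<phi>. (W has_real_derivative slope d v \<phi> 0) (at \<phi>)" and W0: "W 0 = 0"
  shows "\<bar>coeff_trace v\<bar> \<le> \<bar>W (2 * pi)\<bar>"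
proof -
  let ?a = "Poly_Mapping.lookup (fst v)" and ?b = "Poly_Mapping.lookup (snd v)"
  define B where "B \<phi> = angular d v \<phi> (0 :: real)" for \<phi>
  have B: "B \<phi> = (?b (1, 0) * cos \<phi> - ?a (1, 0) * sin \<phi>) * cos \<phi> + (?b (0, 1) * cos \<phi> - ?a (0, 1) * sin \<phi>) * sin \<phi>" for \<phi>
    by (simp add: B_def angular_def polar_sum_0)
  have A: "radial d v \<phi> (0 :: real) = (?a (1, 0) * cos \<phi> + ?b (1, 0) * sin \<phi>) * cos \<phi> + (?a (0, 1) * cos \<phi> + ?b (0, 1) * sin \<phi>) * sin \<phi>" for \<phi>
    by (simp add: radial_def polar_sum_0)
  define B' where "B' \<phi> = coeff_trace v - 2 * radial d v \<phi> (0 :: real)" for \<phi>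
  have dB: "(B has_real_derivative B' \<phi>) (at \<phi>)" for \<phi>
  proof -
    have one: "(cos \<phi>)\<^sup>2 = 1 - (sin \<phi>)\<^sup>2" by (simp add: cos_squared_eq)
    have "(B has_real_derivative
        (- ?b (1, 0) * sin \<phi> - ?a (1, 0) * cos \<phi>) * cos \<phi> - (?b (1, 0) * cos \<phi> - ?a (1, 0) * sin \<phi>) * sin \<phi>
        + ((- ?b (0, 1) * sin \<phi> - ?a (0, 1) * cos \<phi>) * sin \<phi> + (?b (0, 1) * cos \<phi> - ?a (0, 1) * sin \<phi>) * cos \<phi>)) (at \<phi>)"
      unfolding B by (auto intro!: derivative_eq_intros simp: mult.commute)
    moreover have "(- ?b (1, 0) * sin \<phi> - ?a (1, 0) * cos \<phi>) * cos \<phi> - (?b (1, 0) * cos \<phi> - ?a (1, 0) * sin \<phi>) * sin \<phi>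
        + ((- ?b (0, 1) * sin \<phi> - ?a (0, 1) * cos \<phi>) * sin \<phi> + (?b (0, 1) * cos \<phi> - ?a (0, 1) * sin \<phi>) * cos \<phi>) = B' \<phi>"
      unfolding B'_def A coeff_trace_def using one by algebra
    ultimately show ?thesis by metis
  qed
  have Bk: "\<bar>B \<phi>\<bar> \<le> 1 / 80" for \<phi>
    using norm_angular_le[of "0 :: real" \<phi>] kappa_le unfolding B_def real_norm_def norm_zero by linarith
  have B1: "1 + B \<phi> > 0" for \<phi>
    using Bk[of \<phi>] by linarith
  \<comment> \<open>The derivative of \<open>ln (1 + B)\<close> is
    \<open>(coeff_trace v - 2 * radial) / (1 + B)\<close>; adding half of it to the slope cancels
    the radial term.\<close>
  define G where "G \<phi> = W \<phi> + ln (1 + B \<phi>) / 2" for \<phi>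
  have dG: "(G has_real_derivative coeff_trace v / (2 * (1 + B \<phi>))) (at \<phi>)" for \<phi>
  proof -
    have "((\<lambda>\<phi>. ln (1 + B \<phi>)) has_real_derivative B' \<phi> / (1 + B \<phi>)) (at \<phi>)"
      using B1[of \<phi>] by (auto intro!: derivative_eq_intros dB)
    then have "(G has_real_derivative slope d v \<phi> 0 + B' \<phi> / (1 + B \<phi>) / 2) (at \<phi>)"
      unfolding G_def by (intro DERIV_add W DERIV_cdivide)
    moreover have "slope d v \<phi> 0 + B' \<phi> / (1 + B \<phi>) / 2 = coeff_trace v / (2 * (1 + B \<phi>))"
    proof -
      have "x / y + (t - 2 * x) / y / 2 = t / (2 * y)" if "y > 0" for x y t :: real
        using that by (simp add: field_simps)
      then show ?thesis
        unfolding slope_def B_def[symmetric] B'_def using B1[of \<phi>] .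
    qed
    ultimately show ?thesis by metis
  qed
  \<comment> \<open>Over a full turn the periodic logarithm drops out, leaving
    \<open>W (2 * pi) = pi * coeff_trace v / (1 + B z)\<close>. The factor
    \<open>pi / (1 + B z)\<close> is at least 1.\<close>
  have "\<exists>z>0. z < 2 * pi \<and> G (2 * pi) - G 0 = (2 * pi - 0) * (coeff_trace v / (2 * (1 + B z)))"
    by (intro MVT2 dG) auto
  then obtain z where z: "G (2 * pi) - G 0 = (2 * pi - 0) * (coeff_trace v / (2 * (1 + B z)))"
    by blast
  have "B (2 * pi) = B 0" by (simp add: B)
  then have "W (2 * pi) = pi * coeff_trace v / (1 + B z)"
    using z W0 B1[of z] by (simp add: G_def field_simps)
  then have "\<bar>W (2 * pi)\<bar> = (pi / (1 + B z)) * \<bar>coeff_trace v\<bar>"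
    using B1[of z] by (simp add: abs_mult)
  moreover have "1 \<le> pi / (1 + B z)"
    using Bk[of z] B1[of z] pi_ge_two by (simp add: pos_le_divide_eq)
  then have "1 * \<bar>coeff_trace v\<bar> \<le> (pi / (1 + B z)) * \<bar>coeff_trace v\<bar>"
    by (rule mult_right_mono) simp
  ultimately show ?thesis by simp
qed

lemma trace_le_of_returns:
  fixes Z :: "real set" and W :: "real \<Rightarrow> real \<Rightarrow> real"
  assumes Z: "finite Z" "\<And>\<rho>. \<rho> \<in> Z \<Longrightarrow> 0 < \<rho> \<and> \<rho> \<le> 1 / 2"
    and W0: "\<And>\<rho>. \<rho> \<in> Z \<Longrightarrow> W \<rho> 0 = 0" "\<And>\<rho>. \<rho> \<in> Z \<Longrightarrow> W \<rho> (2 * pi) = 0"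
    and W: "\<And>\<rho> \<phi>. \<rho> \<in> Z \<Longrightarrow> (W \<rho> has_real_derivative slope d v \<phi> (\<rho> * exp (W \<rho> \<phi>))) (at \<phi>)"
    and W1: "\<And>\<rho> \<phi>. \<rho> \<in> Z \<Longrightarrow> \<rho> * exp (W \<rho> \<phi>) \<le> 1"
  shows "\<bar>coeff_trace v\<bar> \<le> 9 * \<kappa> * (5 / 9) ^ card Z"
proof -
  define F where "F n z = euler d v (2 * pi / Suc n) z (Suc n)" for n z
  have Sn: "real (Suc n) * (2 * pi / Suc n) \<le> 2 * pi" for n
    by (simp del: of_nat_Suc)
  have holF: "F n holomorphic_on ball 0 (9/10)" for n
    unfolding F_def by (rule euler_holomorphic[OF _ Sn]) simp
  have boundF: "norm (F n z) \<le> 9 * \<kappa>" if "norm z < 9/10" for n z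
  proof -
    have "norm (F n z) \<le> real (Suc n) * (2 * pi / Suc n) * (10 / 9 * \<kappa>)"
      unfolding F_def using norm_euler_le[OF _ that Sn] by (auto simp del: of_nat_Suc euler.simps)
    \<comment> \<open>From \<open>2 * pi < 8\<close> and \<open>80 / 9 < 9\<close>. Keeping
      \<open>\<kappa>\<close> instead of the cruder \<open>1 / 18\<close> makes the bound
      proportional to \<open>coeff_norm v\<close>.\<close>
    also have "\<dots> \<le> (2 * 4) * (10 / 9 * \<kappa>)"
      using pi_less_4 mult_nonneg_nonneg[OF _ kappa_nonneg, of "10 / 9"]
      by (intro mult_right_mono) (auto simp del: of_nat_Suc)
    also have "\<dots> \<le> 9 * \<kappa>" using kappa_nonneg by linarith
    finally show ?thesis .
  qed
  \<comment> \<open>Montel's theorem gives convergence along a subsequence only. This suffices,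
    since at the radii of interest the whole sequence converges by \<open>euler_converges\<close>,
    which determines \<open>g\<close> there.\<close>
  obtain g r where g: "g holomorphic_on ball 0 (9/10)" "strict_mono (r :: nat \<Rightarrow> nat)"
    "\<And>z. z \<in> ball 0 (9/10) \<Longrightarrow> (\<lambda>n. F (r n) z) \<longlonglongrightarrow> g z"
  proof (rule Montel[of "ball 0 (9/10)" "range F" F])
    fix K :: "complex set" assume "compact K" "K \<subseteq> ball 0 (9/10)"
    then show "\<exists>B. \<forall>h\<in>range F. \<forall>z\<in>K. norm (h z) \<le> B"
      using boundF by (intro exI[of _ "9 * \<kappa>"]) auto
  qed (use holF in auto)
  have g_lim: "g (of_real \<rho>) = of_real (w (2 * pi))"
    if "0 \<le> \<rho>" "\<rho> \<le> 1/2" "w 0 = 0" "\<And>\<phi>. (w has_real_derivative slope d v \<phi> (\<rho> * exp (w \<phi>))) (at \<phi>)"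
      "\<And>\<phi>. \<rho> * exp (w \<phi>) \<le> 1" for \<rho> and w :: "real \<Rightarrow> real"
  proof (rule LIMSEQ_unique)
    show "(\<lambda>n. F (r n) (of_real \<rho>)) \<longlonglongrightarrow> g (of_real \<rho>)"
      using that by (intro g) auto
    have "(\<lambda>n. F n (of_real \<rho>)) \<longlonglongrightarrow> of_real (w (2 * pi))"
      unfolding F_def by (rule euler_converges) (use that in auto)
    then show "(\<lambda>n. F (r n) (of_real \<rho>)) \<longlonglongrightarrow> of_real (w (2 * pi))"
      using LIMSEQ_subseq_LIMSEQ[OF _ g(2)] by (force simp: o_def)
  qed
  have g_bound: "norm (g z) \<le> 9 * \<kappa>" if "norm z < 9/10" for z
    by (rule Lim_norm_ubound[OF _ g(3)]) (use that boundF in auto)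
  \<comment> \<open>At radius 0 the right-hand side does not depend on the unknown, so a solution is
    a mere antiderivative.\<close>
  have "\<exists>w. \<forall>x :: real. - \<infinity> < ereal x \<longrightarrow> ereal x < \<infinity> \<longrightarrow> (w has_vector_derivative slope d v x (0 :: real)) (at x)"
  proof (rule einterval_antiderivative)
    have "continuous_on UNIV (\<lambda>\<phi>. slope d v \<phi> (0 :: real))"
      by (intro continuous_on_slope continuous_intros) auto
    then show "isCont (\<lambda>\<phi>. slope d v \<phi> (0 :: real)) x" for x
      by (simp add: continuous_on_eq_continuous_at)
  qed simp
  then obtain w where w: "\<And>x. (w has_real_derivative slope d v x 0) (at x)"
    by (auto simp: has_real_derivative_iff_has_vector_derivative)
  define w0 where "w0 \<phi> = w \<phi> - w 0" for \<phi>
  have w0: "(w0 has_real_derivative slope d v x 0) (at x)" "w0 0 = 0" for x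
    unfolding w0_def by (auto intro!: derivative_eq_intros w)
  \<comment> \<open>Rescaling to the unit disk turns radii at most \<open>1 / 2\<close> into zeros
    of modulus at most \<open>5 / 9\<close>.\<close>
  define f where "f z = g (of_real (9/10) * z)" for z
  have "norm (f 0) \<le> 9 * \<kappa> * (\<Prod>z\<in>(\<lambda>\<rho>. of_real (10 / 9 * \<rho>)) ` Z. norm (z :: complex))"
  proof (rule norm_at_0_le_prod_zeros)
    have "(g \<circ> (\<lambda>z. of_real (9/10) * z)) holomorphic_on ball 0 1"
      by (rule holomorphic_on_compose_gen[OF _ g(1)]) (auto intro!: holomorphic_intros simp: norm_mult norm_divide)
    then show "f holomorphic_on ball 0 1"
      by (simp add: o_def f_def[abs_def])
    show "norm (f z) \<le> 9 * \<kappa>" if "norm z < 1" for z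
      unfolding f_def using that by (intro g_bound) (simp add: norm_mult norm_divide)
    fix z :: complex assume "z \<in> (\<lambda>\<rho>. of_real (10 / 9 * \<rho>)) ` Z"
    then obtain \<rho> where \<rho>: "\<rho> \<in> Z" "z = of_real (10 / 9 * \<rho>)" by blast
    have "g (of_real \<rho>) = of_real (W \<rho> (2 * pi))"
      using Z(2)[OF \<rho>(1)] W0(1)[OF \<rho>(1)] W[OF \<rho>(1)] W1[OF \<rho>(1)] by (intro g_lim) auto
    moreover have "of_real (9/10) * z = of_real \<rho>"
      by (simp add: \<rho>)
    ultimately have "f z = 0"
      using W0(2)[OF \<rho>(1)] by (simp add: f_def)
    moreover have "norm z < 1"
      using Z(2)[OF \<rho>(1)] unfolding \<rho> norm_of_real by simp
    ultimately show "norm z < 1 \<and> f z = 0" by simp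
  qed (use Z in auto)
  also have "(\<Prod>z\<in>(\<lambda>\<rho>. of_real (10 / 9 * \<rho>)) ` Z. norm (z :: complex)) = (\<Prod>\<rho>\<in>Z. \<bar>10 / 9 * \<rho>\<bar>)"
    by (subst prod.reindex) (auto simp: inj_on_def simp del: of_real_mult)
  also have "\<dots> \<le> (\<Prod>\<rho>\<in>Z. 5 / 9)"
  proof (intro prod_mono conjI)
    fix \<rho> assume "\<rho> \<in> Z"
    then show "\<bar>10 / 9 * \<rho>\<bar> \<le> 5 / 9" using Z(2)[of \<rho>] by (simp add: abs_if)
  qed simp
  also have "\<dots> = (5 / 9) ^ card Z" by simp
  finally have "norm (f 0) \<le> 9 * \<kappa> * (5 / 9) ^ card Z"
    using kappa_nonneg by (simp add: mult_left_mono)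
  moreover have "f 0 = of_real (w0 (2 * pi))"
    unfolding f_def using g_lim[of 0 w0] w0 by simp
  moreover have "\<bar>coeff_trace v\<bar> \<le> \<bar>w0 (2 * pi)\<bar>"
    by (rule trace_le_linear_return[OF w0])
  ultimately show ?thesis by simp
qed

end

section \<open>Closed trajectories\<close>

text \<open>Gronwall's argument in both time directions, with the integrating factors
  \<open>exp (- K * t)\<close> and \<open>exp (K * t)\<close>.\<close>

lemma nonneg_zero_of_derivative_le:
  fixes D D' :: "real \<Rightarrow> real"
  assumes D: "\<And>t. (D has_real_derivative D' t) (at t)" and le: "\<And>t. \<bar>D' t\<bar> \<le> K * D t"
    and nonneg: "\<And>t. 0 \<le> D t" and zero: "D t0 = 0"
  shows "D t = 0"
proof (cases "t0 \<le> t")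
  case True
  have "D t * exp (- K * t) \<le> D t0 * exp (- K * t0)"
  proof (rule DERIV_nonpos_imp_nonincreasing[OF True])
    fix s
    have "((\<lambda>s. D s * exp (- K * s)) has_real_derivative (D' s - K * D s) * exp (- K * s)) (at s)"
      by (auto intro!: derivative_eq_intros D simp: algebra_simps)
    moreover have "(D' s - K * D s) * exp (- K * s) \<le> 0"
      using le[of s] by (intro mult_nonpos_nonneg) auto
    ultimately show "\<exists>y. ((\<lambda>s. D s * exp (- K * s)) has_real_derivative y) (at s) \<and> y \<le> 0" by blast
  qed
  then show ?thesis using nonneg[of t] zero by (simp add: mult_le_0_iff)
next
  case False
  then have "t \<le> t0" by simp
  then have "D t * exp (K * t) \<le> D t0 * exp (K * t0)"
  proof (rule DERIV_nonneg_imp_nondecreasing)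
    fix s
    have "((\<lambda>s. D s * exp (K * s)) has_real_derivative (D' s + K * D s) * exp (K * s)) (at s)"
      by (auto intro!: derivative_eq_intros D simp: algebra_simps)
    moreover have "(D' s + K * D s) * exp (K * s) \<ge> 0"
      using le[of s] by (intro mult_nonneg_nonneg) auto
    ultimately show "\<exists>y. ((\<lambda>s. D s * exp (K * s)) has_real_derivative y) (at s) \<and> y \<ge> 0" by blast
  qed
  then show ?thesis using nonneg[of t] zero by (simp add: mult_le_0_iff)
qed

section \<open>Uniqueness of trajectories in the disk\<close>

lemma poly2_lipschitz:
  assumes "\<bar>x\<bar> \<le> 1" "\<bar>y\<bar> \<le> 1" "\<bar>x'\<bar> \<le> 1" "\<bar>y'\<bar> \<le> 1"
  shows "\<bar>poly2 d c x y - poly2 d c x' y'\<bar>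
     \<le> (\<Sum>m\<in>coeff_index d. \<bar>Poly_Mapping.lookup c m\<bar>) * d * (\<bar>x - x'\<bar> + \<bar>y - y'\<bar>)"
proof -
  have pow: "\<bar>a ^ k - b ^ k\<bar> \<le> d * \<bar>a - b\<bar>" if "\<bar>a\<bar> \<le> 1" "\<bar>b\<bar> \<le> 1" "k \<le> d" for a b :: real and k
  proof -
    have "\<bar>a ^ k - b ^ k\<bar> \<le> k * \<bar>a - b\<bar>"
      using norm_power_diff[of a b k] that by simp
    also have "\<dots> \<le> d * \<bar>a - b\<bar>"
      using that by (intro mult_right_mono) auto
    finally show ?thesis .
  qed
  have "\<bar>poly2 d c x y - poly2 d c x' y'\<bar> \<le> (\<Sum>m\<in>coeff_index d. \<bar>Poly_Mapping.lookup c m\<bar> * (d * (\<bar>x - x'\<bar> + \<bar>y - y'\<bar>)))"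
    unfolding poly2_def sum_subtractf[symmetric] real_norm_def[symmetric]
  proof (rule sum_norm_le)
    fix m assume "m \<in> coeff_index d"
    then obtain k i where m: "m = (k, i)" "k \<le> d" "i \<le> d" by (auto simp: coeff_index_def)
    have "\<bar>x ^ k * y ^ i - x' ^ k * y' ^ i\<bar> = \<bar>(x ^ k - x' ^ k) * y ^ i + x' ^ k * (y ^ i - y' ^ i)\<bar>"
      by (simp add: algebra_simps)
    also have "\<dots> \<le> \<bar>x ^ k - x' ^ k\<bar> * \<bar>y ^ i\<bar> + \<bar>x' ^ k\<bar> * \<bar>y ^ i - y' ^ i\<bar>"
      by (simp add: abs_triangle_ineq flip: abs_mult)
    also have "\<dots> \<le> (d * \<bar>x - x'\<bar>) * 1 + 1 * (d * \<bar>y - y'\<bar>)"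
      using assms m by (intro add_mono mult_mono pow) (auto simp: power_abs intro: power_le_one)
    finally have "\<bar>x ^ k * y ^ i - x' ^ k * y' ^ i\<bar> \<le> d * (\<bar>x - x'\<bar> + \<bar>y - y'\<bar>)"
      by (simp add: algebra_simps)
    then have "\<bar>Poly_Mapping.lookup c m\<bar> * \<bar>x ^ k * y ^ i - x' ^ k * y' ^ i\<bar> \<le> \<bar>Poly_Mapping.lookup c m\<bar> * (d * (\<bar>x - x'\<bar> + \<bar>y - y'\<bar>))"
      by (rule mult_left_mono) simp
    then show "norm ((case m of (k, i) \<Rightarrow> Poly_Mapping.lookup c (k, i) * x ^ k * y ^ i) -
       (case m of (k, i) \<Rightarrow> Poly_Mapping.lookup c (k, i) * x' ^ k * y' ^ i))
       \<le> norm (Poly_Mapping.lookup c m) * (d * (norm (x - x') + norm (y - y')))"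
      by (simp add: m(1) mult.assoc flip: right_diff_distrib abs_mult)
  qed
  then show ?thesis by (simp add: sum_distrib_right mult.assoc)
qed

text \<open>Confinement to \<open>half_disk\<close> is built in because the Lipschitz bound for the
  polynomials in \<open>poly2_lipschitz\<close> is available on bounded sets only.\<close>

definition trajectory :: "nat \<Rightarrow> coeffs \<Rightarrow> (real \<Rightarrow> real \<times> real) \<Rightarrow> bool" where
  "trajectory d v \<gamma> \<longleftrightarrow> (\<forall>t. (\<gamma> has_vector_derivative vfield d v (\<gamma> t)) (at t)) \<and> range \<gamma> \<subseteq> half_disk"

lemma trajectory_components:
  assumes "trajectory d v \<gamma>"
  shows "((\<lambda>t. fst (\<gamma> t)) has_real_derivative - snd (\<gamma> t) + poly2 d (fst v) (fst (\<gamma> t)) (snd (\<gamma> t))) (at t)"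
    and "((\<lambda>t. snd (\<gamma> t)) has_real_derivative fst (\<gamma> t) + poly2 d (snd v) (fst (\<gamma> t)) (snd (\<gamma> t))) (at t)"
    and "(fst (\<gamma> t))\<^sup>2 + (snd (\<gamma> t))\<^sup>2 \<le> 1 / 4"
proof -
  have "(\<gamma> has_vector_derivative vfield d v (\<gamma> t)) (at t)"
    using assms by (simp add: trajectory_def)
  from bounded_linear.has_vector_derivative[OF bounded_linear_fst this]
    bounded_linear.has_vector_derivative[OF bounded_linear_snd this]
  show "((\<lambda>t. fst (\<gamma> t)) has_real_derivative - snd (\<gamma> t) + poly2 d (fst v) (fst (\<gamma> t)) (snd (\<gamma> t))) (at t)"
    "((\<lambda>t. snd (\<gamma> t)) has_real_derivative fst (\<gamma> t) + poly2 d (snd v) (fst (\<gamma> t)) (snd (\<gamma> t))) (at t)"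
    by (simp_all add: has_real_derivative_iff_has_vector_derivative vfield_def case_prod_unfold)
  have "\<gamma> t \<in> half_disk"
    using assms by (auto simp: trajectory_def)
  then show "(fst (\<gamma> t))\<^sup>2 + (snd (\<gamma> t))\<^sup>2 \<le> 1 / 4"
    by (simp add: half_disk_def case_prod_unfold)
qed

lemma abs_le_1_of_sum_squares_le:
  assumes "x\<^sup>2 + y\<^sup>2 \<le> (1 / 4 :: real)" shows "\<bar>x\<bar> \<le> 1" "\<bar>y\<bar> \<le> 1"
proof -
  have "x\<^sup>2 \<le> 1" "y\<^sup>2 \<le> 1"
    using assms zero_le_power2[of x] zero_le_power2[of y] by linarith+
  then show "\<bar>x\<bar> \<le> 1" "\<bar>y\<bar> \<le> 1" by (simp_all add: abs_square_le_1)
qed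

lemma trajectory_unique:
  assumes 1: "trajectory d v \<gamma>1" and 2: "trajectory d v \<gamma>2" and eq: "\<gamma>1 s1 = \<gamma>2 s2"
  shows "\<gamma>1 (s1 + t) = \<gamma>2 (s2 + t)"
proof -
  define x where "x t = fst (\<gamma>1 (s1 + t)) - fst (\<gamma>2 (s2 + t))" for t
  define y where "y t = snd (\<gamma>1 (s1 + t)) - snd (\<gamma>2 (s2 + t))" for t
  define P where "P c t = poly2 d c (fst (\<gamma>1 (s1 + t))) (snd (\<gamma>1 (s1 + t)))
      - poly2 d c (fst (\<gamma>2 (s2 + t))) (snd (\<gamma>2 (s2 + t)))" for c t
  define K where "K = (\<Sum>m\<in>coeff_index d. \<bar>Poly_Mapping.lookup (fst v) m\<bar>) * d
      + (\<Sum>m\<in>coeff_index d. \<bar>Poly_Mapping.lookup (snd v) m\<bar>) * d + 1"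
  have shift: "((\<lambda>t. f (s + t)) has_real_derivative D) (at t)"
    if "(f has_real_derivative D) (at (s + t))" for f :: "real \<Rightarrow> real" and s t D
    using that DERIV_shift[of f D t s] by (simp add: add.commute)
  have dx: "(x has_real_derivative - y t + P (fst v) t) (at t)" for t
    unfolding x_def y_def P_def
    by (auto intro!: derivative_eq_intros shift trajectory_components(1)[OF 1] trajectory_components(1)[OF 2])
  have dy: "(y has_real_derivative x t + P (snd v) t) (at t)" for t
    unfolding x_def y_def P_def
    by (auto intro!: derivative_eq_intros shift trajectory_components(2)[OF 1] trajectory_components(2)[OF 2])
  let ?K = "\<lambda>c :: (nat \<times> nat) \<Rightarrow>\<^sub>0 real. (\<Sum>m\<in>coeff_index d. \<bar>Poly_Mapping.lookup c m\<bar>) * d"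
  have P: "\<bar>P c t\<bar> \<le> ?K c * (\<bar>x t\<bar> + \<bar>y t\<bar>)" for c t
    unfolding P_def x_def y_def
    by (intro poly2_lipschitz abs_le_1_of_sum_squares_le(1)[OF trajectory_components(3)[OF 1]]
        abs_le_1_of_sum_squares_le(2)[OF trajectory_components(3)[OF 1]]
        abs_le_1_of_sum_squares_le(1)[OF trajectory_components(3)[OF 2]]
        abs_le_1_of_sum_squares_le(2)[OF trajectory_components(3)[OF 2]])
  have K: "?K (fst v) \<le> K - 1" "?K (snd v) \<le> K - 1" "K \<ge> 0"
    by (auto simp: K_def sum_nonneg)
  define D where "D t = (x t)\<^sup>2 + (y t)\<^sup>2" for t
  \<comment> \<open>The rotation terms \<open>- y\<close> and \<open>x\<close> cancel in the
    derivative of the squared distance, so only the polynomial differences remain.\<close>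
  have dD: "(D has_real_derivative 2 * x t * P (fst v) t + 2 * y t * P (snd v) t) (at t)" for t
    unfolding D_def by (auto intro!: derivative_eq_intros dx dy simp: algebra_simps)
  have le: "\<bar>2 * x t * P (fst v) t + 2 * y t * P (snd v) t\<bar> \<le> (4 * K) * D t" for t
  proof -
    let ?s = "\<bar>x t\<bar> + \<bar>y t\<bar>"
    have PK: "\<bar>P c t\<bar> \<le> K * ?s" if "c \<in> {fst v, snd v}" for c
      using P[of c t] mult_right_mono[of "?K c" K ?s] K that by fastforce
    have "\<bar>2 * x t * P (fst v) t + 2 * y t * P (snd v) t\<bar> \<le> 2 * (\<bar>x t\<bar> * \<bar>P (fst v) t\<bar>) + 2 * (\<bar>y t\<bar> * \<bar>P (snd v) t\<bar>)"
      by (intro order_trans[OF abs_triangle_ineq]) (simp add: abs_mult)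
    also have "\<dots> \<le> 2 * (\<bar>x t\<bar> * (K * ?s)) + 2 * (\<bar>y t\<bar> * (K * ?s))"
      by (intro add_mono mult_left_mono PK) auto
    also have "\<dots> = 2 * K * ?s\<^sup>2" by (simp add: power2_eq_square algebra_simps)
    also have "\<dots> \<le> 2 * K * (2 * D t)"
    proof (rule mult_left_mono)
      have "0 \<le> (\<bar>x t\<bar> - \<bar>y t\<bar>)\<^sup>2" by simp
      then show "?s\<^sup>2 \<le> 2 * D t" by (simp add: D_def power2_sum power2_diff)
    qed (use K in auto)
    finally show ?thesis by simp
  qed
  have nonneg: "0 \<le> D t" for t by (simp add: D_def)
  have zero: "D 0 = 0" by (simp add: D_def x_def y_def eq)
  have "D t = 0"
    using nonneg_zero_of_derivative_le[OF dD le nonneg zero] .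
  then have "x t = 0" "y t = 0"
    by (simp_all add: D_def sum_power2_eq_zero_iff)
  then show ?thesis by (simp add: x_def y_def prod_eq_iff)
qed

lemma poly2_origin: "poly2 d c 0 0 = 0"
  unfolding poly2_def by (intro sum.neutral) (auto simp: coeff_index_def zero_power)

text \<open>The origin is an equilibrium, so by uniqueness a trajectory through it is constant. This
  makes polar coordinates available along the whole trajectory.\<close>

lemma trajectory_nonzero:
  assumes "trajectory d v \<gamma>" "\<not> \<gamma> constant_on UNIV"
  shows "\<gamma> t \<noteq> (0, 0)"
proof
  assume 0: "\<gamma> t = (0, 0)"
  have "trajectory d v (\<lambda>t. (0, 0))"
    using has_vector_derivative_const[of "(0 :: real, 0 :: real)"]
    by (simp add: trajectory_def vfield_def poly2_origin half_disk_def zero_prod_def)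
  from trajectory_unique[OF assms(1) this, of t, OF 0]
  have "\<gamma> (t + (s - t)) = (0, 0)" for s .
  then have "\<gamma> s = (0, 0)" for s by simp
  then show False
    using assms(2) by (auto simp: constant_on_def)
qed

lemma poly2_polar:
  "cos \<phi> * poly2 d (fst v) (r * cos \<phi>) (r * sin \<phi>) + sin \<phi> * poly2 d (snd v) (r * cos \<phi>) (r * sin \<phi>) = r * radial d v \<phi> r"
  "cos \<phi> * poly2 d (snd v) (r * cos \<phi>) (r * sin \<phi>) - sin \<phi> * poly2 d (fst v) (r * cos \<phi>) (r * sin \<phi>) = r * angular d v \<phi> r"
proof -
  have pow: "(r * cos \<phi>) ^ k * (r * sin \<phi>) ^ i = r * (cos \<phi> ^ k * sin \<phi> ^ i * r ^ (k + i - 1))"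
    if "(k, i) \<in> coeff_index d" for k i
  proof -
    have "k + i = Suc (k + i - 1)"
      using that by (auto simp: coeff_index_def)
    then have "r ^ k * r ^ i = r * r ^ (k + i - 1)"
      by (metis power_add power_Suc)
    then show ?thesis by (simp add: power_mult_distrib mult_ac)
  qed
  have eq: "poly2 d c (r * cos \<phi>) (r * sin \<phi>) =
     (\<Sum>(k, i)\<in>coeff_index d. Poly_Mapping.lookup c (k, i) * (r * (cos \<phi> ^ k * sin \<phi> ^ i * r ^ (k + i - 1))))" for c
    unfolding poly2_def by (rule sum.cong[OF refl]) (clarsimp simp only: mult.assoc pow)
  show "cos \<phi> * poly2 d (fst v) (r * cos \<phi>) (r * sin \<phi>) + sin \<phi> * poly2 d (snd v) (r * cos \<phi>) (r * sin \<phi>) = r * radial d v \<phi> r"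
    unfolding eq radial_def polar_sum_def sum_distrib_left sum.distrib[symmetric]
    by (rule sum.cong[OF refl]) (simp add: case_prod_unfold algebra_simps)
  show "cos \<phi> * poly2 d (snd v) (r * cos \<phi>) (r * sin \<phi>) - sin \<phi> * poly2 d (fst v) (r * cos \<phi>) (r * sin \<phi>) = r * angular d v \<phi> r"
    unfolding eq angular_def polar_sum_def sum_distrib_left sum_subtractf[symmetric]
    by (rule sum.cong[OF refl]) (simp add: case_prod_unfold algebra_simps)
qed

section \<open>From closed trajectories to periodic solutions of the polar equation\<close>

context small_field
begin

lemma slope_unique:
  fixes W1 W2 :: "real \<Rightarrow> real"
  assumes W1: "\<And>\<phi>. (W1 has_real_derivative slope d v \<phi> (exp (W1 \<phi>))) (at \<phi>)" "\<And>\<phi>. W1 \<phi> \<le> 0"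
    and W2: "\<And>\<phi>. (W2 has_real_derivative slope d v \<phi> (exp (W2 \<phi>))) (at \<phi>)" "\<And>\<phi>. W2 \<phi> \<le> 0"
    and eq: "W1 \<phi>0 = W2 \<phi>0"
  shows "W1 \<phi> = W2 \<phi>"
proof -
  obtain L where L: "L \<ge> 0" "\<And>\<phi> r s :: real. \<bar>r\<bar> \<le> 1 \<Longrightarrow> \<bar>s\<bar> \<le> 1 \<Longrightarrow>
     \<bar>slope d v \<phi> r - slope d v \<phi> s\<bar> \<le> L * \<bar>r - s\<bar>"
    using slope_lipschitz[where 'a=real] by auto
  have exp_lip: "exp b - exp a \<le> b - a" if "a \<le> b" "b \<le> 0" for a b :: real
  proof -
    have "exp b * (1 + (a - b)) \<le> exp b * exp (a - b)"
      by (intro mult_left_mono exp_ge_add_one_self) auto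
    then have "exp b - exp a \<le> exp b * (b - a)"
      by (simp add: exp_diff algebra_simps)
    also have "\<dots> \<le> 1 * (b - a)"
      using that by (intro mult_right_mono) auto
    finally show ?thesis by simp
  qed
  have exp_lip': "\<bar>exp a - exp b\<bar> \<le> \<bar>a - b\<bar>" if "a \<le> 0" "b \<le> 0" for a b :: real
    using exp_lip[of a b] exp_lip[of b a] that by (cases "a \<le> b") (auto simp: abs_if)
  define D where "D \<phi> = (W1 \<phi> - W2 \<phi>)\<^sup>2" for \<phi>
  define S where "S \<phi> = slope d v \<phi> (exp (W1 \<phi>)) - slope d v \<phi> (exp (W2 \<phi>))" for \<phi>
  have dD: "(D has_real_derivative 2 * (W1 \<phi> - W2 \<phi>) * S \<phi>) (at \<phi>)" for \<phi>
    unfolding D_def S_def by (auto intro!: derivative_eq_intros W1 W2)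
  have le: "\<bar>2 * (W1 \<phi> - W2 \<phi>) * S \<phi>\<bar> \<le> (2 * L) * D \<phi>" for \<phi>
  proof -
    have "\<bar>S \<phi>\<bar> \<le> L * \<bar>exp (W1 \<phi>) - exp (W2 \<phi>)\<bar>"
      unfolding S_def using W1(2) W2(2) by (intro L(2)) auto
    also have "\<dots> \<le> L * \<bar>W1 \<phi> - W2 \<phi>\<bar>"
      using L(1) W1(2) W2(2) by (intro mult_left_mono exp_lip') auto
    finally have "2 * \<bar>W1 \<phi> - W2 \<phi>\<bar> * \<bar>S \<phi>\<bar> \<le> 2 * \<bar>W1 \<phi> - W2 \<phi>\<bar> * (L * \<bar>W1 \<phi> - W2 \<phi>\<bar>)"
      by (rule mult_left_mono) simp
    moreover have "D \<phi> = \<bar>W1 \<phi> - W2 \<phi>\<bar> * \<bar>W1 \<phi> - W2 \<phi>\<bar>"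
      by (simp add: D_def power2_eq_square flip: abs_mult)
    ultimately show ?thesis
      by (simp only: abs_mult abs_numeral mult_ac)
  qed
  have nonneg: "0 \<le> D \<phi>" for \<phi> by (simp add: D_def)
  have zero: "D \<phi>0 = 0" by (simp add: D_def eq)
  have "D \<phi> = 0"
    using nonneg_zero_of_derivative_le[OF dD le nonneg zero] .
  then show ?thesis by (simp add: D_def)
qed

lemma slope_periodic: "slope d v (\<phi> + 2 * pi) = slope d v \<phi>"
  by (rule ext) (simp add: slope_def radial_def angular_def polar_sum_def)

text \<open>A closed trajectory might close up only after \<open>m\<close> turns. The increments
  over single turns telescope to 0 over \<open>m\<close> turns, so their continuous function
  \<open>D\<close> cannot keep one sign and vanishes somewhere; uniqueness then makes the solution
  periodic after one turn.\<close>

lemma slope_solution_periodic: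
  fixes W :: "real \<Rightarrow> real"
  assumes W: "\<And>\<phi>. (W has_real_derivative slope d v \<phi> (exp (W \<phi>))) (at \<phi>)" "\<And>\<phi>. W \<phi> \<le> 0"
    and m: "m > 0" "W (\<phi>0 + 2 * pi * real m) = W \<phi>0"
  shows "W (\<phi> + 2 * pi) = W \<phi>"
proof -
  have W': "((\<lambda>\<phi>. W (\<phi> + 2 * pi)) has_real_derivative slope d v \<phi> (exp (W (\<phi> + 2 * pi)))) (at \<phi>)" for \<phi>
    using W(1)[of "\<phi> + 2 * pi"] by (subst DERIV_shift[symmetric]) (simp add: slope_periodic)
  define D where "D \<phi> = W (\<phi> + 2 * pi) - W \<phi>" for \<phi>
  have contD: "continuous_on S D" for S
    unfolding D_def by (intro continuous_intros continuous_at_imp_continuous_on ballI DERIV_isCont[OF W(1)] DERIV_isCont[OF W'])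
  have sum: "(\<Sum>j<m. D (\<phi>0 + 2 * pi * real j)) = 0"
  proof -
    have "(\<Sum>j<m. D (\<phi>0 + 2 * pi * real j)) = (\<Sum>j<m. W (\<phi>0 + 2 * pi * real (Suc j)) - W (\<phi>0 + 2 * pi * real j))"
      by (intro sum.cong) (auto simp: D_def algebra_simps)
    also have "\<dots> = W (\<phi>0 + 2 * pi * real m) - W \<phi>0"
      by (subst sum_lessThan_telescope) simp
    finally show ?thesis using m by simp
  qed
  have "\<exists>x. D x = 0"
  proof (rule ccontr)
    assume nz: "\<nexists>x. D x = 0"
    have conn: "connected (range D)"
      by (intro connected_continuous_image contD) simp
    have "(\<forall>x. D x > 0) \<or> (\<forall>x. D x < 0)"
    proof (rule ccontr)
      assume "\<not> ?thesis"
      then obtain x y where "D x \<le> 0" "D y \<ge> 0" by (auto simp: not_less)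
      then have "0 \<in> range D"
        using conn unfolding connected_iff_interval by blast
      then show False using nz by force
    qed
    then show False
    proof
      assume "\<forall>x. D x > 0"
      then have "0 < (\<Sum>j<m. D (\<phi>0 + 2 * pi * real j))"
        using m(1) by (intro sum_pos) auto
      with sum show False by simp
    next
      assume "\<forall>x. D x < 0"
      then have "0 < (\<Sum>j<m. - D (\<phi>0 + 2 * pi * real j))"
        using m(1) by (intro sum_pos) auto
      with sum show False by (simp add: sum_negf)
    qed
  qed
  then obtain x where "W (x + 2 * pi) = W x" by (auto simp: D_def)
  then show ?thesis
    by (rule slope_unique[OF W' W(2) W])
qed

text \<open>A continuous branch of the logarithm along the curve is obtained by integrating
  \<open>u' / u\<close>, since \<open>u * exp (- F)\<close> then has derivative 0. Its real and
  imaginary parts are \<open>ln r\<close> and the angle, with their derivatives given at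
  once.\<close>

lemma trajectory_polar_lift:
  assumes \<gamma>: "trajectory d v \<gamma>" and nc: "\<not> \<gamma> constant_on UNIV"
  obtains a \<theta> where
    "\<And>t. \<gamma> t = (exp (a t) * cos (\<theta> t), exp (a t) * sin (\<theta> t))"
    "\<And>t. (a has_real_derivative radial d v (\<theta> t) (exp (a t))) (at t)"
    "\<And>t. (\<theta> has_real_derivative 1 + angular d v (\<theta> t) (exp (a t))) (at t)"
proof -
  define x where "x t = fst (\<gamma> t)" for t
  define y where "y t = snd (\<gamma> t)" for t
  define x' where "x' t = - y t + poly2 d (fst v) (x t) (y t)" for t
  define y' where "y' t = x t + poly2 d (snd v) (x t) (y t)" for t
  have dx: "(x has_real_derivative x' t) (at t)" and dy: "(y has_real_derivative y' t) (at t)" for t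
    using trajectory_components[OF \<gamma>] by (simp_all add: x_def[abs_def] y_def[abs_def] x'_def y'_def)
  define u where "u t = Complex (x t) (y t)" for t
  define u' where "u' t = Complex (x' t) (y' t)" for t
  have u_eq: "u = (\<lambda>t. of_real (x t) + \<i> * of_real (y t))" "u' = (\<lambda>t. of_real (x' t) + \<i> * of_real (y' t))"
    by (auto simp: u_def u'_def complex_eq_iff)
  have du: "(u has_vector_derivative u' t) (at t)" for t
    unfolding u_eq using dx[of t] dy[of t]
    by (auto intro!: derivative_eq_intros has_vector_derivative_mult_right
        bounded_linear.has_vector_derivative[OF bounded_linear_of_real] simp: has_real_derivative_iff_has_vector_derivative)
  have u0: "u t \<noteq> 0" for t
    using trajectory_nonzero[OF \<gamma> nc, of t] by (auto simp: u_def x_def y_def complex_eq_iff prod_eq_iff)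
  have contx: "isCont x t" and conty: "isCont y t" for t
    using dx dy by (auto intro: DERIV_isCont)
  have "isCont (\<lambda>t. poly2 d c (x t) (y t)) t" for c t
    unfolding poly2_def case_prod_unfold by (intro continuous_intros contx conty)
  then have "isCont u t" "isCont u' t" for t
    unfolding u_eq x'_def y'_def by (auto intro!: continuous_intros contx conty)
  then have "isCont (\<lambda>t. u' t / u t) t" for t
    using u0 by (intro continuous_intros)
  then have "\<exists>F. \<forall>t :: real. - \<infinity> < ereal t \<longrightarrow> ereal t < \<infinity> \<longrightarrow> (F has_vector_derivative (u' t / u t)) (at t)"
    by (intro einterval_antiderivative) auto
  then obtain F where F: "\<And>t. (F has_vector_derivative (u' t / u t)) (at t)"
    by auto
  have dE: "((\<lambda>t. exp (- F t)) has_vector_derivative - (u' t / u t) * exp (- F t)) (at t)" for t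
  proof -
    have "((\<lambda>t. - F t) has_vector_derivative - (u' t / u t)) (at t)"
      by (intro has_vector_derivative_minus F)
    from field_vector_diff_chain_at[OF this DERIV_exp] show ?thesis
      by (simp add: o_def)
  qed
  have const: "((\<lambda>t. u t * exp (- F t)) has_vector_derivative 0) (at t)" for t
  proof -
    have zero: "u t * (- (u' t / u t) * exp (- F t)) + u' t * exp (- F t) = 0"
      using u0[of t] by simp
    from has_vector_derivative_mult[OF du dE, of t] show ?thesis
      unfolding zero .
  qed
  obtain c where c: "\<And>t. u t * exp (- F t) = c"
  proof (rule has_vector_derivative_zero_constant[OF convex_UNIV])
    show "((\<lambda>t. u t * exp (- F t)) has_vector_derivative 0) (at t within UNIV)" for t
      by (rule const)
  qed (use that in blast)
  have c0: "c \<noteq> 0" using c[of 0] u0[of 0] by auto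
  define l where "l t = F t + Ln c" for t
  have ul: "u t = exp (l t)" for t
    using c[of t] c0 by (simp add: l_def exp_add exp_minus field_simps)
  have dl: "(l has_vector_derivative (u' t / u t)) (at t)" for t
    unfolding l_def by (auto intro!: derivative_eq_intros F)
  define a where "a t = Re (l t)" for t
  define \<theta> where "\<theta> t = Im (l t)" for t
  have xy: "x t = exp (a t) * cos (\<theta> t)" "y t = exp (a t) * sin (\<theta> t)" for t
  proof -
    have "x t = Re (exp (l t))" "y t = Im (exp (l t))"
      by (simp_all flip: ul) (simp_all add: u_def)
    then show "x t = exp (a t) * cos (\<theta> t)" "y t = exp (a t) * sin (\<theta> t)"
      by (simp_all add: a_def \<theta>_def Re_exp Im_exp)
  qed
  have da: "(a has_real_derivative Re (u' t / u t)) (at t)" and d\<theta>: "(\<theta> has_real_derivative Im (u' t / u t)) (at t)" for t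
    unfolding a_def \<theta>_def has_real_derivative_iff_has_vector_derivative
    using bounded_linear.has_vector_derivative[OF bounded_linear_Re dl]
      bounded_linear.has_vector_derivative[OF bounded_linear_Im dl] by auto
  have quot: "Re (u' t / u t) = radial d v (\<theta> t) (exp (a t))" "Im (u' t / u t) = 1 + angular d v (\<theta> t) (exp (a t))" for t
  proof -
    define r where "r = exp (a t)"
    define s where "s = sin (\<theta> t)"
    define q where "q = cos (\<theta> t)"
    define P where "P = poly2 d (fst v) (r * q) (r * s)"
    define Q where "Q = poly2 d (snd v) (r * q) (r * s)"
    have r: "r > 0" by (simp add: r_def)
    have sq: "q\<^sup>2 + s\<^sup>2 = 1" by (simp add: q_def s_def)
    have u: "u t = Complex (r * q) (r * s)" "u' t = Complex (- (r * s) + P) (r * q + Q)"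
      by (simp_all add: u_def u'_def x'_def y'_def xy r_def s_def q_def P_def Q_def)
    have n: "(r * q)\<^sup>2 + (r * s)\<^sup>2 = r\<^sup>2"
      using sq by (simp add: power_mult_distrib flip: distrib_left)
    have R: "q * P + s * Q = r * radial d v (\<theta> t) r" and A: "q * Q - s * P = r * angular d v (\<theta> t) r"
      using poly2_polar[of "\<theta> t" d v r] by (simp_all add: P_def Q_def s_def q_def)
    have "Re (u' t / u t) = ((- (r * s) + P) * (r * q) + (r * q + Q) * (r * s)) / r\<^sup>2"
      by (simp add: u Re_divide n)
    also have "(- (r * s) + P) * (r * q) + (r * q + Q) * (r * s) = r * (q * P + s * Q)"
      by (simp add: algebra_simps)
    finally show "Re (u' t / u t) = radial d v (\<theta> t) (exp (a t))"
      using r by (simp add: R power2_eq_square r_def)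
    have "Im (u' t / u t) = ((r * q + Q) * (r * q) - (- (r * s) + P) * (r * s)) / r\<^sup>2"
      by (simp add: u Im_divide n)
    also have "(r * q + Q) * (r * q) - (- (r * s) + P) * (r * s) = ((r * q)\<^sup>2 + (r * s)\<^sup>2) + r * (q * Q - s * P)"
      by (simp add: algebra_simps power2_eq_square)
    also have "\<dots> = r\<^sup>2 * (1 + angular d v (\<theta> t) r)"
      unfolding n A by (simp add: power2_eq_square distrib_left)
    finally show "Im (u' t / u t) = 1 + angular d v (\<theta> t) (exp (a t))"
      using r by (simp add: r_def)
  qed
  show ?thesis
  proof
    show "\<gamma> t = (exp (a t) * cos (\<theta> t), exp (a t) * sin (\<theta> t))" for t
      by (simp add: prod_eq_iff flip: x_def y_def xy)
  qed (use da d\<theta> in \<open>simp_all add: quot\<close>)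
qed

text \<open>The angle grows at rate at least \<open>9 / 10\<close>, so it maps the time line
  bijectively onto the line and can replace time as the independent variable. The trajectory becomes
  a global solution \<open>w\<close> of the scalar equation, which
  \<open>slope_solution_periodic\<close> shows to return after one turn.\<close>

lemma closed_trajectory_return:
  assumes ct: "closed_trajectory d v \<Gamma>" and \<Gamma>: "\<Gamma> \<subseteq> half_disk"
  obtains \<rho> W where "0 < \<rho>" "\<rho> \<le> 1 / 2" "(\<rho>, 0) \<in> \<Gamma>" "W 0 = 0" "W (2 * pi) = 0"
    "\<And>\<phi>. (W has_real_derivative slope d v \<phi> (\<rho> * exp (W \<phi>))) (at \<phi>)"
    "\<And>\<phi>. \<rho> * exp (W \<phi>) \<le> 1"
proof -
  obtain \<gamma> p where p: "p > 0" and per: "\<And>t. \<gamma> (t + p) = \<gamma> t" and nc: "\<not> \<gamma> constant_on UNIV"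
    and \<gamma>: "trajectory d v \<gamma>" and ran: "\<Gamma> = range \<gamma>"
    using ct \<Gamma> unfolding closed_trajectory_def trajectory_def by blast
  obtain a \<theta> where polar: "\<And>t. \<gamma> t = (exp (a t) * cos (\<theta> t), exp (a t) * sin (\<theta> t))"
    and da: "\<And>t. (a has_real_derivative radial d v (\<theta> t) (exp (a t))) (at t)"
    and d\<theta>: "\<And>t. (\<theta> has_real_derivative 1 + angular d v (\<theta> t) (exp (a t))) (at t)"
    using trajectory_polar_lift[OF \<gamma> nc] by blast
  have radius: "exp (a t) \<le> 1 / 2" for t
  proof -
    have "(fst (\<gamma> t))\<^sup>2 + (snd (\<gamma> t))\<^sup>2 = (exp (a t))\<^sup>2 * ((cos (\<theta> t))\<^sup>2 + (sin (\<theta> t))\<^sup>2)"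
      unfolding polar fst_conv snd_conv by (simp only: power_mult_distrib distrib_left)
    then have "(exp (a t))\<^sup>2 \<le> 1 / 4"
      using trajectory_components(3)[OF \<gamma>, of t] by simp
    then have "(exp (a t))\<^sup>2 \<le> (1 / 2)\<^sup>2"
      by (simp add: power2_eq_square)
    then show ?thesis
      by (rule power2_le_imp_le) simp
  qed
  have ang: "9/10 \<le> 1 + angular d v (\<theta> t) (exp (a t))" for t
  proof -
    have "\<bar>angular d v (\<theta> t) (exp (a t))\<bar> \<le> \<kappa>"
    proof -
      have "exp (a t) \<le> 1" using radius[of t] by linarith
      then show ?thesis using norm_angular_le[of "exp (a t)" "\<theta> t"] by simp
    qed
    then show ?thesis using kappa_le by linarith
  qed
  have incr: "9/10 * (t - s) \<le> \<theta> t - \<theta> s" if "s < t" for s t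
  proof -
    have "\<exists>z>s. z < t \<and> \<theta> t - \<theta> s = (t - s) * (1 + angular d v (\<theta> z) (exp (a z)))"
      by (rule MVT2[OF that]) (rule d\<theta>)
    then obtain z where z: "\<theta> t - \<theta> s = (t - s) * (1 + angular d v (\<theta> z) (exp (a z)))"
      by blast
    show ?thesis
      unfolding z using mult_left_mono[OF ang[of z], of "t - s"] that by (simp add: mult.commute)
  qed
  have inj: "inj \<theta>"
  proof (rule injI)
    fix s t assume "\<theta> s = \<theta> t" then show "s = t"
      using incr[of s t] incr[of t s] by (cases s t rule: linorder_cases) auto
  qed
  have cont\<theta>: "continuous_on UNIV \<theta>"
    using d\<theta> by (meson DERIV_isCont continuous_at_imp_continuous_on)
  have surj: "\<exists>t. \<theta> t = \<phi>" for \<phi>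
  proof -
    \<comment> \<open>Within time \<open>T\<close> the angle moves by at least
      \<open>9 / 10 * T\<close>, which exceeds the distance from \<open>\<theta> 0\<close> to
      \<open>\<phi>\<close>; the summand 1 keeps \<open>T\<close> positive.\<close>
    define T where "T = 2 * (\<bar>\<phi>\<bar> + \<bar>\<theta> 0\<bar>) + 1"
    have "T > 0" by (simp add: T_def add_nonneg_pos)
    have "\<bar>\<phi>\<bar> + \<bar>\<theta> 0\<bar> \<le> 9/10 * T" by (simp add: T_def)
    moreover have "9/10 * T \<le> \<theta> T - \<theta> 0"
      using incr[OF \<open>T > 0\<close>] by simp
    ultimately have upper: "\<phi> \<le> \<theta> T" by linarith
    have "\<bar>\<phi>\<bar> + \<bar>\<theta> 0\<bar> \<le> 9/10 * T" by (simp add: T_def)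
    moreover have "9/10 * T \<le> \<theta> 0 - \<theta> (- T)"
      using incr[of "- T" 0] \<open>T > 0\<close> by simp
    ultimately have lower: "\<theta> (- T) \<le> \<phi>" by linarith
    have "- T \<le> T" using \<open>T > 0\<close> by simp
    with lower upper obtain t where "\<theta> t = \<phi>"
      using IVT'[of \<theta> "-T" \<phi> T] continuous_on_subset[OF cont\<theta>] by blast
    then show ?thesis ..
  qed
  define g where "g = inv \<theta>"
  have g: "\<theta> (g \<phi>) = \<phi>" "g (\<theta> t) = t" for \<phi> t
    using surj inj by (simp_all add: g_def f_inv_into_f image_iff) (metis f_inv_into_f rangeI)
  have dg: "(g has_real_derivative inverse (1 + angular d v \<phi> (exp (a (g \<phi>))))) (at \<phi>)" for \<phi>
  proof -
    have "(g has_real_derivative inverse (1 + angular d v (\<theta> (g \<phi>)) (exp (a (g \<phi>))))) (at (\<theta> (g \<phi>)))"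
      using ang[of "g \<phi>"] g(2)
      by (intro has_field_derivative_inverse_strong[OF d\<theta> _ open_UNIV UNIV_I cont\<theta>]) auto
    then show ?thesis by (simp add: g)
  qed
  define w where "w \<phi> = a (g \<phi>)" for \<phi>
  have dw: "(w has_real_derivative slope d v \<phi> (exp (w \<phi>))) (at \<phi>)" for \<phi>
    using DERIV_chain2[OF da dg, of \<phi>] by (simp add: w_def[abs_def] slope_def g divide_inverse)
  have w0: "w \<phi> \<le> 0" for \<phi>
  proof -
    have "exp (w \<phi>) \<le> 1" using radius[of "g \<phi>"] unfolding w_def by linarith
    then show ?thesis by simp
  qed
  \<comment> \<open>After one time period the logarithm of the point changes by an integer multiple
    of the period of \<open>exp\<close>; growth of the angle makes that integer positive.\<close>
  obtain m :: nat where m: "m > 0" "\<theta> p = \<theta> 0 + 2 * pi * real m" "a p = a 0"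
  proof -
    have "\<gamma> p = \<gamma> 0" using per[of 0] by simp
    then have "exp (Complex (a p) (\<theta> p)) = exp (Complex (a 0) (\<theta> 0))"
      by (simp add: polar complex_eq_iff Re_exp Im_exp)
    then obtain n :: int where n: "Complex (a p) (\<theta> p) = Complex (a 0) (\<theta> 0) + of_real (of_int (2 * n) * pi) * \<i>"
      unfolding exp_eq by blast
    then have 1: "a p = a 0" "\<theta> p = \<theta> 0 + 2 * pi * of_int n"
      by (auto simp: complex_eq_iff)
    moreover have "n > 0"
    proof -
      have "9/10 * p \<le> 2 * pi * of_int n"
        using incr[OF p] 1(2) by simp
      then have "0 < 2 * pi * of_int n" using p by linarith
      then show ?thesis by (simp add: zero_less_mult_iff)
    qed
    ultimately show ?thesis
      using that[of "nat n"] by simp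
  qed
  have "w (\<theta> 0 + 2 * pi * real m) = w (\<theta> 0)"
    using m(2,3) g(2)[of p] g(2)[of 0] by (simp add: w_def)
  then have w2pi: "w (2 * pi) = w 0"
    using slope_solution_periodic[OF dw w0 m(1), of "\<theta> 0" 0] by simp
  \<comment> \<open>The radius of the trajectory at angle 0. Subtracting \<open>w 0\<close>
    normalizes the solution to start at 0, as the Euler polygons do.\<close>
  define \<rho> where "\<rho> = exp (w 0)"
  define W where "W \<phi> = w \<phi> - w 0" for \<phi>
  have \<rho>W: "\<rho> * exp (W \<phi>) = exp (w \<phi>)" for \<phi>
    by (simp add: \<rho>_def W_def exp_diff)
  show ?thesis
  proof
    show "0 < \<rho>" "\<rho> \<le> 1 / 2" using radius by (auto simp: \<rho>_def w_def)
    have "\<gamma> (g 0) = (\<rho>, 0)" by (simp add: polar g \<rho>_def w_def)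
    then show "(\<rho>, 0) \<in> \<Gamma>" unfolding ran by (metis rangeI)
    show "W 0 = 0" "W (2 * pi) = 0" by (simp_all add: W_def w2pi)
    show "(W has_real_derivative slope d v \<phi> (\<rho> * exp (W \<phi>))) (at \<phi>)" for \<phi>
      unfolding \<rho>W unfolding W_def by (auto intro!: derivative_eq_intros dw)
    show "\<rho> * exp (W \<phi>) \<le> 1" for \<phi>
      unfolding \<rho>W using w0 by simp
  qed
qed

text \<open>Ensures that different closed trajectories meet the positive axis in different points,
  so that each one contributes its own zero.\<close>

lemma closed_trajectory_unique:
  assumes "closed_trajectory d v \<Gamma>1" "\<Gamma>1 \<subseteq> half_disk" "closed_trajectory d v \<Gamma>2" "\<Gamma>2 \<subseteq> half_disk"
    and "z \<in> \<Gamma>1" "z \<in> \<Gamma>2"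
  shows "\<Gamma>1 = \<Gamma>2"
proof -
  obtain \<gamma>1 \<gamma>2 where \<gamma>: "trajectory d v \<gamma>1" "\<Gamma>1 = range \<gamma>1" "trajectory d v \<gamma>2" "\<Gamma>2 = range \<gamma>2"
    using assms(1-4) unfolding closed_trajectory_def trajectory_def by blast
  then obtain s1 s2 where s: "\<gamma>1 s1 = \<gamma>2 s2"
    using assms(5,6) by auto
  have eq: "\<gamma>1 (s1 + t) = \<gamma>2 (s2 + t)" for t
    by (rule trajectory_unique[OF \<gamma>(1,3) s])
  have "\<gamma>1 t = \<gamma>2 (s2 + (t - s1))" "\<gamma>2 t = \<gamma>1 (s1 + (t - s2))" for t
    using eq[of "t - s1"] eq[of "t - s2"] by simp_all
  then have "\<gamma>1 t \<in> range \<gamma>2" "\<gamma>2 t \<in> range \<gamma>1" for t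
    by (blast intro: range_eqI)+
  then show ?thesis
    unfolding \<gamma>(2,4) by blast
qed

lemma trace_le_of_closed_trajectories:
  assumes S: "finite S" "\<And>\<Gamma>. \<Gamma> \<in> S \<Longrightarrow> closed_trajectory d v \<Gamma> \<and> \<Gamma> \<subseteq> half_disk"
  shows "\<bar>coeff_trace v\<bar> \<le> 9 * \<kappa> * (5 / 9) ^ card S"
proof -
  have "\<forall>\<Gamma>\<in>S. \<exists>\<rho> W. 0 < \<rho> \<and> \<rho> \<le> 1 / 2 \<and> (\<rho>, 0) \<in> \<Gamma> \<and> W 0 = 0 \<and> W (2 * pi) = 0 \<and>
    (\<forall>\<phi>. (W has_real_derivative slope d v \<phi> (\<rho> * exp (W \<phi>))) (at \<phi>)) \<and> (\<forall>\<phi>. \<rho> * exp (W \<phi>) \<le> 1)"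
  proof
    fix \<Gamma> assume "\<Gamma> \<in> S"
    then have "closed_trajectory d v \<Gamma>" "\<Gamma> \<subseteq> half_disk" using S(2) by auto
    then show "\<exists>\<rho> W. 0 < \<rho> \<and> \<rho> \<le> 1 / 2 \<and> (\<rho>, 0) \<in> \<Gamma> \<and> W 0 = 0 \<and> W (2 * pi) = 0 \<and>
      (\<forall>\<phi>. (W has_real_derivative slope d v \<phi> (\<rho> * exp (W \<phi>))) (at \<phi>)) \<and> (\<forall>\<phi>. \<rho> * exp (W \<phi>) \<le> 1)"
      by (rule closed_trajectory_return) blast
  qed
  then obtain R W where R: "\<And>\<Gamma>. \<Gamma> \<in> S \<Longrightarrow> 0 < R \<Gamma> \<and> R \<Gamma> \<le> 1 / 2 \<and> (R \<Gamma>, 0) \<in> \<Gamma>"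
    and W: "\<And>\<Gamma>. \<Gamma> \<in> S \<Longrightarrow> W \<Gamma> 0 = 0 \<and> W \<Gamma> (2 * pi) = 0 \<and>
    (\<forall>\<phi>. (W \<Gamma> has_real_derivative slope d v \<phi> (R \<Gamma> * exp (W \<Gamma> \<phi>))) (at \<phi>)) \<and> (\<forall>\<phi>. R \<Gamma> * exp (W \<Gamma> \<phi>) \<le> 1)"
    by metis
  have inj: "inj_on R S"
    by (rule inj_onI) (metis R S(2) closed_trajectory_unique)
  \<comment> \<open>\<open>trace_le_of_returns\<close> indexes solutions by their radius;
    injectivity of \<open>R\<close> recovers the trajectory from it.\<close>
  let ?W = "\<lambda>\<rho>. W (the_inv_into S R \<rho>)"
  have "\<bar>coeff_trace v\<bar> \<le> 9 * \<kappa> * (5 / 9) ^ card (R ` S)"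
    by (rule trace_le_of_returns[where W = ?W]) (use S(1) R W in \<open>auto simp: the_inv_into_f_f[OF inj]\<close>)
  then show ?thesis by (simp add: card_image[OF inj])
qed

lemma trace_le_of_num_limit_cycles:
  assumes T: "0 \<le> T" and num: "ennreal T \<le> num_limit_cycles d v"
  shows "\<bar>coeff_trace v\<bar> \<le> 9 * \<kappa> * exp (- ln (9 / 5) * T)"
proof -
  let ?S = "{\<Gamma>. limit_cycle d v \<Gamma> \<and> \<Gamma> \<subseteq> half_disk}"
  \<comment> \<open>Rounding \<open>T\<close> up is harmless for the exponent, as
    \<open>T \<le> m\<close>, and selecting exactly \<open>m\<close> cycles treats finite and
    infinite sets of limit cycles alike.\<close>
  define m where "m = nat \<lceil>T\<rceil>"
  have mT: "T \<le> real m" unfolding m_def using T by linarith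
  obtain S where S: "finite S" "S \<subseteq> ?S" "card S = m"
  proof (cases "finite ?S")
    case True
    then have "ennreal T \<le> ennreal (real (card ?S))"
      using num by (simp add: num_limit_cycles_def emeasure_count_space ennreal_of_nat_eq_real_of_nat)
    then have "m \<le> card ?S"
      unfolding m_def by (simp add: ennreal_le_iff nat_le_iff ceiling_le_iff)
    then show ?thesis
      using obtain_subset_with_card_n[of m ?S] that by metis
  next
    case False
    then show ?thesis
      using infinite_arbitrarily_large[of ?S m] that by metis
  qed
  have "\<bar>coeff_trace v\<bar> \<le> 9 * \<kappa> * (5 / 9) ^ card S"
    using S by (intro trace_le_of_closed_trajectories) (auto simp: limit_cycle_def)
  also have "(5 / 9 :: real) ^ card S = exp (- ln (9 / 5) * real m)"
  proof -
    have "exp (- ln (9 / 5 :: real)) = 5 / 9"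
      by (simp add: exp_minus)
    then show ?thesis
      by (metis S(3) exp_of_nat_mult mult.commute)
  qed
  also have "9 * \<kappa> * exp (- ln (9 / 5) * real m) \<le> 9 * \<kappa> * exp (- ln (9 / 5) * T)"
    using mT kappa_nonneg by (intro mult_left_mono) auto
  finally show ?thesis .
qed

end

theorem theorem1p3:
  shows "\<exists>C1 C2 C3 :: real. C1 > 0 \<and> C2 > 0 \<and> C3 > 0 \<and>
    (\<forall>(d :: nat) (N :: real) (\<delta> :: real) (V :: coeffs set).
       2 \<le> d \<longrightarrow>
       0 < N \<longrightarrow> N \<le> 1 / (40 * pi * sqrt (real d)) \<longrightarrow>
       0 < \<delta> \<longrightarrow>
       V \<subseteq> coeff_ball d N \<longrightarrow> convex V \<longrightarrow>
       emeasure lebesgue (ball (0 :: real ^ 4) N) / emeasure lebesgue (linear_part ` V) \<le> ennreal \<delta> \<longrightarrow>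
       (\<forall>T :: real. 0 \<le> T \<longrightarrow>
          hull_measure V {v \<in> V. num_limit_cycles d v \<ge> ennreal T}
            \<le> ennreal (C1 * \<delta> * real d powr C2 * exp (- C3 * T)) * hull_measure V V))"
proof (rule exI[of _ 10368], rule exI[of _ "5 / 2"], rule exI[of _ "ln (9 / 5)"], intro conjI allI impI)
  fix d :: nat and N \<delta> :: real and V :: "coeffs set" and T :: real
  assume d: "2 \<le> d" and N: "0 < N" "N \<le> 1 / (40 * pi * sqrt (real d))" and \<delta>: "0 < \<delta>"
    and V: "V \<subseteq> coeff_ball d N" "convex V"
    and ratio: "emeasure lebesgue (ball (0 :: real ^ 4) N) / emeasure lebesgue (linear_part ` V) \<le> ennreal \<delta>"
    and T: "0 \<le> T"
  have Vs: "V \<subseteq> coeff_space d"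
    using V(1) by (auto simp: coeff_ball_def)
  define E where "E = exp (- ln (9 / 5) * T)"
  \<comment> \<open>\<open>N\<close> in place of \<open>coeff_norm v\<close> gives one slab for all
    \<open>v\<close> in \<open>V\<close>.\<close>
  define \<epsilon> where "\<epsilon> = 9 * (sqrt (real d) * N) * E"
  have eps: "\<epsilon> > 0" using d N by (simp add: \<epsilon>_def E_def)
  obtain v0 where v0: "v0 \<in> V" "N / (32 * \<delta>) \<le> \<bar>coeff_trace v0\<bar>"
    using exists_large_trace[OF N(1) \<delta> V(1) ratio] by blast
  have sub: "{v \<in> V. ennreal T \<le> num_limit_cycles d v} \<subseteq> {v \<in> V. \<bar>coeff_trace v\<bar> \<le> \<epsilon>}"
  proof safe
    fix v assume vV: "v \<in> V" "ennreal T \<le> num_limit_cycles d v"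
    then have norm: "coeff_norm v \<le> N"
      using V(1) by (auto simp: coeff_ball_def)
    have "sqrt (real d) * coeff_norm v \<le> sqrt (real d) * N"
      using norm by (intro mult_left_mono) auto
    also have "\<dots> \<le> sqrt (real d) * (1 / (40 * pi * sqrt (real d)))"
      using N by (intro mult_left_mono) auto
    also have "\<dots> = 1 / (40 * pi)" using d by simp
    finally interpret small_field d v
      using vV Vs d by unfold_locales auto
    have "\<bar>coeff_trace v\<bar> \<le> 9 * (sqrt (real d) * coeff_norm v) * E"
      unfolding E_def by (rule trace_le_of_num_limit_cycles[OF T vV(2)])
    also have "\<dots> \<le> \<epsilon>"
      unfolding \<epsilon>_def using norm by (intro mult_right_mono mult_left_mono) (auto simp: E_def)
    finally show "\<bar>coeff_trace v\<bar> \<le> \<epsilon>" .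
  qed
  have h: "N / (32 * \<delta>) > 0" using N \<delta> by simp
  have "hull_measure V {v \<in> V. ennreal T \<le> num_limit_cycles d v} \<le> hull_measure V {v \<in> V. \<bar>coeff_trace v\<bar> \<le> \<epsilon>}"
    by (rule hull_measure_mono[OF sub])
  also have "\<dots> \<le> ennreal (12 * \<epsilon> * (d * (d + 3) + 1) / (N / (32 * \<delta>))) * hull_measure V V"
    by (rule hull_measure_small_trace_le[OF Vs V(2) v0 h eps])
  \<comment> \<open>The constant is \<open>10368 = 12 * 9 * 32 * 3\<close>: slab estimate, bound on
    \<open>g\<close>, reach of the trace, and \<open>s + 1 \<le> 3 * d ^ 2\<close>. The exponent
    \<open>5 / 2\<close> adds the 2 from the dimension to the \<open>1 / 2\<close> from
    \<open>sqrt d\<close>.\<close>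
  also have "\<dots> \<le> ennreal (10368 * \<delta> * real d powr (5 / 2) * exp (- ln (9 / 5) * T)) * hull_measure V V"
  proof (intro mult_right_mono ennreal_leI)
    have "real (d * (d + 3) + 1) \<le> 3 * (real d)\<^sup>2"
    proof -
      \<comment> \<open>The difference \<open>3 * d ^ 2 - (d * (d + 3) + 1)\<close> equals
        \<open>(d - 2) * (2 * d + 1) + 1\<close>.\<close>
      have "0 \<le> (real d - 2) * (2 * real d + 1)" using d by (intro mult_nonneg_nonneg) auto
      then show ?thesis by (simp add: algebra_simps power2_eq_square)
    qed
    then have "3456 * \<delta> * sqrt (real d) * E * real (d * (d + 3) + 1) \<le> 3456 * \<delta> * sqrt (real d) * E * (3 * (real d)\<^sup>2)"
      using \<delta> by (intro mult_left_mono) (auto simp: E_def)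
    also have "3456 * \<delta> * sqrt (real d) * E * real (d * (d + 3) + 1) = 12 * \<epsilon> * (d * (d + 3) + 1) / (N / (32 * \<delta>))"
      using N by (simp add: \<epsilon>_def)
    also have "3456 * \<delta> * sqrt (real d) * E * (3 * (real d)\<^sup>2) = 10368 * \<delta> * ((real d)\<^sup>2 * sqrt (real d)) * E"
      by simp
    also have "(real d)\<^sup>2 * sqrt (real d) = real d powr (5 / 2)"
    proof -
      have "real d powr (5 / 2) = real d powr (2 + 1 / 2)" by simp
      also have "\<dots> = real d powr 2 * real d powr (1 / 2)" by (rule powr_add)
      finally show ?thesis using d by (simp add: powr_half_sqrt)
    qed
    finally show "12 * \<epsilon> * (d * (d + 3) + 1) / (N / (32 * \<delta>)) \<le> 10368 * \<delta> * real d powr (5 / 2) * exp (- ln (9 / 5) * T)"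
      unfolding E_def .
  qed simp
  finally show "hull_measure V {v \<in> V. ennreal T \<le> num_limit_cycles d v}
     \<le> ennreal (10368 * \<delta> * real d powr (5 / 2) * exp (- ln (9 / 5) * T)) * hull_measure V V" .
qed auto

end
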